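(* Let $V$ be a $\mathbb{K}$-vector space and let $\varpi:T(V)\otimes T(V)\longrightarrow V$ be a linear map. Define a bilinear product $\bullet$ on $T(V)$ by $$u\bullet v=u^{(1)}\,\varpi(u^{(2)}\otimes v^{(1)})\,(u^{(3)}\mathbin{\sqcup\!\sqcup} v^{(2)})\qquad (u,v\in T(V)),$$ and assume that for all $u,v,w\in T(V)$: (A) $\varpi((u\mathbin{\sqcup\!\sqcup} v)\otimes w)=\varepsilon(u)\varpi(v\otimes w)+\varepsilon(v)\varpi(u\otimes w)$; (B) $\varpi(u\bullet v\otimes w)-\varpi(u\otimes v\bullet w)=\varpi(u\bullet w\otimes v)-\varpi(u\otimes w\bullet v)$. Then $(T(V),\mathbin{\sqcup\!\sqcup},\bullet,\Delta)$ is a Com-PreLie bialgebra. Moreover every product $\bullet$ on $T(V)$ such that $(T(V),\mathbin{\sqcup\!\sqcup},\bullet,\Delta)$ is a Com-PreLie bialgebra is obtained in this way from some $\varpi$ satisfying (A) and (B). Finally, for any $N\in\mathbb{Z}$, $\bullet$ is homogeneous of degree $N$ (that is, $V^{\otimes k}\bullet V^{\otimes l}\subseteq V^{\otimes(k+l+N)}$ for all $k,l\ge 0$, with $V^{\otimes p}=(0)$ if $p<0$) if, and only if, for all $k,l\in\mathbb{N}$, $k+l+N\neq 1$ implies $\varpi(V^{\otimes k}\otimes V^{\otimes l})=(0)$.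
   Context: $\mathbb{K}$ is a field of characteristic zero. $T(V)=\bigoplus_{n\ge0}V^{\otimes n}$; elements are written as words, the empty word is $\emptyset$; $\mathbin{\sqcup\!\sqcup}$ is the shuffle product (with unit $\emptyset$), $\Delta(v_1\ldots v_n)=\sum_{i=0}^n v_1\ldots v_i\otimes v_{i+1}\ldots v_n$ is deconcatenation, $\varepsilon$ its counit. Sweedler notation is used for iterated coproducts: $\Delta(v)=v^{(1)}\otimes v^{(2)}$, $(\Delta\otimes \mathrm{Id})\Delta(u)=u^{(1)}\otimes u^{(2)}\otimes u^{(3)}$. In the formula for $u\bullet v$, juxtaposition is concatenation of words ($\varpi(\cdot)\in V$ being a letter). This $\bullet$ is the unique product such that $\pi(u\bullet v)=\varpi(u\otimes v)$, where $\pi:T(V)\to V$ is the canonical projection, and $\Delta(u\bullet v)=u^{(1)}\otimes u^{(2)}\bullet v+u^{(1)}\bullet v^{(1)}\otimes u^{(2)}\mathbin{\sqcup\!\sqcup} v^{(2)}$ for all $u,v$. A Com-PreLie algebra is a vector space $A$ with bilinear products $\cdot,\bullet$ such that $\cdot$ is associative and commutative, $(a\bullet b)\bullet c-a\bullet(b\bullet c)=(a\bullet c)\bullet b-a\bullet(c\bullet b)$ and $(a\cdot b)\bullet c=(a\bullet c)\cdot b+a\cdot(b\bullet c)$ for all $a,b,c$; it is unitary if $(A,\cdot)$ has a unit. A Com-PreLie bialgebra is $(A,\cdot,\bullet,\Delta)$ with $(A,\cdot,\bullet)$ a unitary Com-PreLie algebra, $(A,\cdot,\Delta)$ a bialgebra,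 and $\Delta(a\bullet b)=a^{(1)}\otimes a^{(2)}\bullet b+a^{(1)}\bullet b^{(1)}\otimes a^{(2)}\cdot b^{(2)}$ for all $a,b\in A$. *)

theory Defs
  imports Complex_Main "HOL-Library.Poly_Mapping"
begin

section \<open>Formal linear combinations and tensors\<close>

text \<open>The free vector space on a type \<open>'x\<close> is \<open>'x \<Rightarrow>\<^sub>0 'k\<close>. Vector spaces are given by
  the locale \<^locale>\<open>vector_space\<close> on a type, so the scalar multiplication is always an
  explicit parameter.\<close>

definition fscale :: "'k::field \<Rightarrow> ('x \<Rightarrow>\<^sub>0 'k) \<Rightarrow> ('x \<Rightarrow>\<^sub>0 'k)"
  where "fscale c p = Poly_Mapping.map ((*) c) p"

definition lin_ext :: "('k::field \<Rightarrow> 'w \<Rightarrow> 'w) \<Rightarrow> ('x \<Rightarrow> 'w) \<Rightarrow> ('x \<Rightarrow>\<^sub>0 'k) \<Rightarrow> 'w::ab_group_add"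
  where "lin_ext s f p = (\<Sum>x\<in>Poly_Mapping.keys p. s (Poly_Mapping.lookup p x) (f x))"

definition bilinear_map ::
  "('k::field \<Rightarrow> 'a::ab_group_add \<Rightarrow> 'a) \<Rightarrow> ('k \<Rightarrow> 'b::ab_group_add \<Rightarrow> 'b)
    \<Rightarrow> ('k \<Rightarrow> 'c::ab_group_add \<Rightarrow> 'c) \<Rightarrow> ('a \<Rightarrow> 'b \<Rightarrow> 'c) \<Rightarrow> bool"
  where "bilinear_map s1 s2 s3 B \<longleftrightarrow>
    (\<forall>x. Vector_Spaces.linear s2 s3 (B x)) \<and> (\<forall>y. Vector_Spaces.linear s1 s3 (\<lambda>x. B x y))"

abbreviation ten :: "'a list \<Rightarrow> ('a list \<Rightarrow>\<^sub>0 'k::field)"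
  where "ten xs \<equiv> Poly_Mapping.single xs 1"

text \<open>The direct sum of all tensor powers of a vector space \<open>A\<close> is the free vector space on the
  lists over \<open>A\<close>, modulo multilinearity: the class of \<open>ten [a\<^sub>1, \<dots>, a\<^sub>n]\<close> is
  \<open>a\<^sub>1 \<otimes> \<dots> \<otimes> a\<^sub>n\<close>. Instead of forming the quotient, elements of \<open>A \<otimes> A\<close> and
  \<open>A \<otimes> A \<otimes> A\<close> are written as formal sums and compared with \<open>tens_eq\<close>, which is equality
  in the quotient.\<close>

definition multilin_rels :: "('k::field \<Rightarrow> 'a::ab_group_add \<Rightarrow> 'a) \<Rightarrow> ('a list \<Rightarrow>\<^sub>0 'k) set"
  where "multilin_rels s = module.span fscale
    ({ten (xs @ (a + b) # ys) - ten (xs @ a # ys) - ten (xs @ b # ys) | xs a b ys. True} \<union>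
     {ten (xs @ s c a # ys) - fscale c (ten (xs @ a # ys)) | xs c a ys. True})"

definition tens_eq ::
  "('k::field \<Rightarrow> 'a::ab_group_add \<Rightarrow> 'a) \<Rightarrow> ('a list \<Rightarrow>\<^sub>0 'k) \<Rightarrow> ('a list \<Rightarrow>\<^sub>0 'k) \<Rightarrow> bool"
  where "tens_eq s p q \<longleftrightarrow> p - q \<in> multilin_rels s"

section \<open>Com-PreLie bialgebras\<close>

text \<open>A coproduct is a map \<open>\<Delta> :: 'a \<Rightarrow> ('a \<times> 'a \<Rightarrow>\<^sub>0 'k)\<close> assigning to \<open>a\<close> a formal sum of
  pairs that represents the element of \<open>A \<otimes> A\<close> in question; only its class modulo
  bilinearity matters. \<open>sweedler s (\<Delta> a) (\<lambda>x y. E x y)\<close> is the Sweedler expression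
  \<open>E a\<^sup>(\<^sup>1\<^sup>) a\<^sup>(\<^sup>2\<^sup>)\<close>.\<close>

definition sweedler ::
  "('k::field \<Rightarrow> 'w \<Rightarrow> 'w) \<Rightarrow> ('a \<times> 'a \<Rightarrow>\<^sub>0 'k) \<Rightarrow> ('a \<Rightarrow> 'a \<Rightarrow> 'w) \<Rightarrow> 'w::ab_group_add"
  where "sweedler s d E = lin_ext s (\<lambda>(x, y). E x y) d"

definition tens :: "('a \<times> 'a \<Rightarrow>\<^sub>0 'k::field) \<Rightarrow> ('a list \<Rightarrow>\<^sub>0 'k)"
  where "tens d = sweedler fscale d (\<lambda>x y. ten [x, y])"

locale com_prelie_algebra = vector_space scale
  for scale :: "'k::field \<Rightarrow> 'a::ab_group_add \<Rightarrow> 'a" +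
  fixes mul bul :: "'a \<Rightarrow> 'a \<Rightarrow> 'a"
  assumes mul_bilinear: "bilinear_map scale scale scale mul"
    and bul_bilinear: "bilinear_map scale scale scale bul"
    and mul_assoc: "mul (mul a b) c = mul a (mul b c)"
    and mul_comm: "mul a b = mul b a"
    and prelie: "bul (bul a b) c - bul a (bul b c) = bul (bul a c) b - bul a (bul c b)"
    and leibniz: "bul (mul a b) c = mul (bul a c) b + mul a (bul b c)"

locale unitary_com_prelie_algebra = com_prelie_algebra +
  assumes mul_unit: "\<exists>e. \<forall>a. mul e a = a \<and> mul a e = a"

locale bialgebra_on = vector_space scale
  for scale :: "'k::field \<Rightarrow> 'a::ab_group_add \<Rightarrow> 'a" +
  fixes mul :: "'a \<Rightarrow> 'a \<Rightarrow> 'a"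
    and unit :: 'a
    and \<Delta> :: "'a \<Rightarrow> ('a \<times> 'a \<Rightarrow>\<^sub>0 'k)"
    and \<epsilon> :: "'a \<Rightarrow> 'k"
  assumes bialg_mul_bilinear: "bilinear_map scale scale scale mul"
    and bialg_mul_assoc: "mul (mul a b) c = mul a (mul b c)"
    and bialg_unit: "mul unit a = a" "mul a unit = a"
    and coprod_add: "tens_eq scale (tens (\<Delta> (a + b))) (tens (\<Delta> a) + tens (\<Delta> b))"
    and coprod_scale: "tens_eq scale (tens (\<Delta> (scale r a))) (fscale r (tens (\<Delta> a)))"
    and coassoc: "tens_eq scale
      (sweedler fscale (\<Delta> a) (\<lambda>x y. sweedler fscale (\<Delta> x) (\<lambda>x1 x2. ten [x1, x2, y])))
      (sweedler fscale (\<Delta> a) (\<lambda>x y. sweedler fscale (\<Delta> y) (\<lambda>y1 y2. ten [x, y1, y2])))"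
    and counit_linear: "Vector_Spaces.linear scale (*) \<epsilon>"
    and counit_left: "sweedler scale (\<Delta> a) (\<lambda>x y. scale (\<epsilon> x) y) = a"
    and counit_right: "sweedler scale (\<Delta> a) (\<lambda>x y. scale (\<epsilon> y) x) = a"
    and coprod_mul: "tens_eq scale (tens (\<Delta> (mul a b)))
      (sweedler fscale (\<Delta> a) (\<lambda>x y. sweedler fscale (\<Delta> b) (\<lambda>z w. ten [mul x z, mul y w])))"
    and coprod_unit: "tens_eq scale (tens (\<Delta> unit)) (ten [unit, unit])"
    and counit_mul: "\<epsilon> (mul a b) = \<epsilon> a * \<epsilon> b"
    and counit_unit: "\<epsilon> unit = 1"

definition is_bialgebra ::
  "('k::field \<Rightarrow> 'a::ab_group_add \<Rightarrow> 'a) \<Rightarrow> ('a \<Rightarrow> 'a \<Rightarrow> 'a) \<Rightarrow> ('a \<Rightarrow> ('a \<times> 'a \<Rightarrow>\<^sub>0 'k)) \<Rightarrow> bool"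
  where "is_bialgebra scale mul \<Delta> \<longleftrightarrow> (\<exists>unit \<epsilon>. bialgebra_on scale mul unit \<Delta> \<epsilon>)"

locale com_prelie_bialgebra = unitary_com_prelie_algebra scale mul bul
  for scale :: "'k::field \<Rightarrow> 'a::ab_group_add \<Rightarrow> 'a" and mul bul +
  fixes \<Delta> :: "'a \<Rightarrow> ('a \<times> 'a \<Rightarrow>\<^sub>0 'k)"
  assumes bialgebra: "is_bialgebra scale mul \<Delta>"
    and coprod_bul: "tens_eq scale (tens (\<Delta> (bul a b)))
      (sweedler fscale (\<Delta> a) (\<lambda>x y. ten [x, bul y b]) +
       sweedler fscale (\<Delta> a) (\<lambda>x y. sweedler fscale (\<Delta> b) (\<lambda>z w. ten [bul x z, mul y w])))"

section \<open>The tensor algebra of a vector space\<close>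

definition word :: "('v \<Rightarrow> 't::ring_1) \<Rightarrow> 'v list \<Rightarrow> 't"
  where "word \<iota> vs = prod_list (map \<iota> vs)"

text \<open>An algebra \<open>T\<close> with a linear map \<open>\<iota> : V \<rightarrow> T\<close> is (a copy of) the tensor algebra
  \<open>T(V)\<close> when the canonical map from formal combinations of words over \<open>V\<close> to \<open>T\<close> is
  onto, with kernel the multilinearity relations; that is, when it identifies \<open>T\<close> with the usual
  quotient construction of the direct sum of the tensor powers of \<open>V\<close>. The multiplication of
  \<open>T\<close> is concatenation and \<open>1\<close> is the empty word. (\<open>T(V)\<close> depends on the scalar
  multiplication of \<open>V\<close>, so it cannot be a single type constructor applied to the type of
  \<open>V\<close>; see \<open>tensor_algebra_free\<close> below for a model.)\<close>

locale tensor_algebra = Vector_Spaces.linear sV sT \<iota>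
  for sV :: "'k::field \<Rightarrow> 'v::ab_group_add \<Rightarrow> 'v"
    and sT :: "'k \<Rightarrow> 't::ring_1 \<Rightarrow> 't"
    and \<iota> :: "'v \<Rightarrow> 't" +
  assumes mult_scale: "sT c x * y = sT c (x * y)" "x * sT c y = sT c (x * y)"
    and words_surj: "surj (lin_ext sT (word \<iota>))"
    and words_kernel: "{p. lin_ext sT (word \<iota>) p = 0} = multilin_rels sV"

text \<open>Linear maps on \<open>T\<close> are given by their values on words, which have to be multilinear in the
  letters. The choice of the representing formal combination is then irrelevant, see
  \<open>shuffle_word\<close>, \<open>deconc_word\<close> and \<open>counit_word\<close> below.\<close>

definition on_words ::
  "('k::field \<Rightarrow> 't \<Rightarrow> 't) \<Rightarrow> ('v \<Rightarrow> 't::ring_1) \<Rightarrow> ('k \<Rightarrow> 'w \<Rightarrow> 'w) \<Rightarrow> ('v list \<Rightarrow> 'w::ab_group_add)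
    \<Rightarrow> 't \<Rightarrow> 'w"
  where "on_words sT \<iota> s f x = lin_ext s f (SOME p. lin_ext sT (word \<iota>) p = x)"

text \<open>All shuffles of two words, with multiplicity (unlike \<^const>\<open>shuffles\<close>).\<close>

fun shuffle_list :: "'v list \<Rightarrow> 'v list \<Rightarrow> 'v list list" where
  "shuffle_list [] v = [v]"
| "shuffle_list u [] = [u]"
| "shuffle_list (a # u) (b # v) =
    map ((#) a) (shuffle_list u (b # v)) @ map ((#) b) (shuffle_list (a # u) v)"

definition shuffle ::
  "('k::field \<Rightarrow> 't \<Rightarrow> 't) \<Rightarrow> ('v \<Rightarrow> 't::ring_1) \<Rightarrow> 't \<Rightarrow> 't \<Rightarrow> 't"
  where "shuffle sT \<iota> x y =
    on_words sT \<iota> sT (\<lambda>u. on_words sT \<iota> sT (\<lambda>v. \<Sum>w\<leftarrow>shuffle_list u v. word \<iota> w) y) x"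

definition deconc ::
  "('k::field \<Rightarrow> 't \<Rightarrow> 't) \<Rightarrow> ('v \<Rightarrow> 't::ring_1) \<Rightarrow> 't \<Rightarrow> ('t \<times> 't \<Rightarrow>\<^sub>0 'k)"
  where "deconc sT \<iota> = on_words sT \<iota> fscale
    (\<lambda>w. \<Sum>i\<le>length w. Poly_Mapping.single (word \<iota> (take i w), word \<iota> (drop i w)) 1)"

definition counit :: "('k::field \<Rightarrow> 't \<Rightarrow> 't) \<Rightarrow> ('v \<Rightarrow> 't::ring_1) \<Rightarrow> 't \<Rightarrow> 'k"
  where "counit sT \<iota> = on_words sT \<iota> (*) (\<lambda>w. if w = [] then 1 else 0)"

definition tpow :: "('k::field \<Rightarrow> 't \<Rightarrow> 't) \<Rightarrow> ('v \<Rightarrow> 't::ring_1) \<Rightarrow> int \<Rightarrow> 't set"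
  where "tpow sT \<iota> p =
    (if p < 0 then {0} else module.span sT {word \<iota> ws | ws. int (length ws) = p})"

text \<open>The product \<open>u \<bullet> v = u\<^sup>(\<^sup>1\<^sup>) \<omega>(u\<^sup>(\<^sup>2\<^sup>) \<otimes> v\<^sup>(\<^sup>1\<^sup>)) (u\<^sup>(\<^sup>3\<^sup>) \<squnion> v\<^sup>(\<^sup>2\<^sup>))\<close>, with \<open>\<squnion>\<close> the shuffle
  product and \<open>u\<^sup>(\<^sup>1\<^sup>) \<otimes> u\<^sup>(\<^sup>2\<^sup>) \<otimes> u\<^sup>(\<^sup>3\<^sup>) = (\<Delta> \<otimes> Id) (\<Delta> u)\<close>. A linear map on \<open>T \<otimes> T\<close>
  is given by the corresponding bilinear map on \<open>T\<close>.\<close>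

definition bullet ::
  "('k::field \<Rightarrow> 't \<Rightarrow> 't) \<Rightarrow> ('v \<Rightarrow> 't::ring_1) \<Rightarrow> ('t \<Rightarrow> 't \<Rightarrow> 'v) \<Rightarrow> 't \<Rightarrow> 't \<Rightarrow> 't"
  where "bullet sT \<iota> \<omega> u v =
    sweedler sT (deconc sT \<iota> u) (\<lambda>u12 u3.
      sweedler sT (deconc sT \<iota> u12) (\<lambda>u1 u2.
        sweedler sT (deconc sT \<iota> v) (\<lambda>v1 v2.
          u1 * \<iota> (\<omega> u2 v1) * shuffle sT \<iota> u3 v2)))"

definition cond_A ::
  "('k::field \<Rightarrow> 'v::ab_group_add \<Rightarrow> 'v) \<Rightarrow> ('k \<Rightarrow> 't \<Rightarrow> 't) \<Rightarrow> ('v \<Rightarrow> 't::ring_1) \<Rightarrow> ('t \<Rightarrow> 't \<Rightarrow> 'v) \<Rightarrow> bool"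
  where "cond_A sV sT \<iota> \<omega> \<longleftrightarrow> (\<forall>u v w.
    \<omega> (shuffle sT \<iota> u v) w = sV (counit sT \<iota> u) (\<omega> v w) + sV (counit sT \<iota> v) (\<omega> u w))"

definition cond_B ::
  "('k::field \<Rightarrow> 't \<Rightarrow> 't) \<Rightarrow> ('v::ab_group_add \<Rightarrow> 't::ring_1) \<Rightarrow> ('t \<Rightarrow> 't \<Rightarrow> 'v) \<Rightarrow> bool"
  where "cond_B sT \<iota> \<omega> \<longleftrightarrow> (\<forall>u v w.
    \<omega> (bullet sT \<iota> \<omega> u v) w - \<omega> u (bullet sT \<iota> \<omega> v w) =
    \<omega> (bullet sT \<iota> \<omega> u w) v - \<omega> u (bullet sT \<iota> \<omega> w v))"

definition homogeneous ::
  "('k::field \<Rightarrow> 't \<Rightarrow> 't) \<Rightarrow> ('v \<Rightarrow> 't::ring_1) \<Rightarrow> int \<Rightarrow> ('t \<Rightarrow> 't \<Rightarrow> 't) \<Rightarrow> bool"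
  where "homogeneous sT \<iota> N bul \<longleftrightarrow> (\<forall>k l :: nat. \<forall>x \<in> tpow sT \<iota> (int k). \<forall>y \<in> tpow sT \<iota> (int l).
    bul x y \<in> tpow sT \<iota> (int k + int l + N))"

section \<open>The operations on words\<close>

lemma lookup_fscale [simp]: "Poly_Mapping.lookup (fscale c p) x = c * Poly_Mapping.lookup p x"
  by (simp add: fscale_def Poly_Mapping.map.rep_eq when_def)

lemma vector_space_fscale: "vector_space fscale"
  by unfold_locales (auto intro!: poly_mapping_eqI simp: lookup_add algebra_simps)

lemma lin_ext_superset:
  assumes "vector_space s" "finite A" "Poly_Mapping.keys p \<subseteq> A"
  shows "lin_ext s f p = (\<Sum>x\<in>A. s (Poly_Mapping.lookup p x) (f x))"
proof -
  interpret vector_space s by fact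
  show ?thesis unfolding lin_ext_def
    by (rule sum.mono_neutral_left) (use assms in \<open>auto simp: in_keys_iff\<close>)
qed

lemma linear_lin_ext:
  assumes "vector_space s"
  shows "Vector_Spaces.linear fscale s (lin_ext s f)"
proof -
  interpret vector_space s by fact
  interpret F: vector_space fscale by (rule vector_space_fscale)
  show ?thesis
  proof unfold_locales
    fix p q :: "'c \<Rightarrow>\<^sub>0 'a"
    let ?A = "Poly_Mapping.keys p \<union> Poly_Mapping.keys q"
    have "Poly_Mapping.keys (p + q) \<subseteq> ?A" by (rule Poly_Mapping.keys_add)
    then show "lin_ext s f (p + q) = lin_ext s f p + lin_ext s f q"
      by (subst (1 2 3) lin_ext_superset[of s ?A, OF assms])
        (auto simp: lookup_add scale_left_distrib sum.distrib)
  next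
    fix c :: 'a and p :: "'c \<Rightarrow>\<^sub>0 'a"
    have "Poly_Mapping.keys (fscale c p) \<subseteq> Poly_Mapping.keys p"
      by (auto simp: in_keys_iff)
    then show "lin_ext s f (fscale c p) = s c (lin_ext s f p)"
      by (subst (1 2) lin_ext_superset[of s "Poly_Mapping.keys p", OF assms])
        (auto simp: scale_sum_right)
  qed
qed

lemma lin_ext_single [simp]:
  assumes "vector_space s"
  shows "lin_ext s f (Poly_Mapping.single x c) = s c (f x)"
proof -
  interpret vector_space s by fact
  show ?thesis by (simp add: lin_ext_def)
qed

lemma lin_ext_rels:
  assumes "vector_space s"
    and add: "\<And>xs a b ys. P (f (xs @ (a + b) # ys) - f (xs @ a # ys) - f (xs @ b # ys))"
    and scale: "\<And>xs c a ys. P (f (xs @ sV c a # ys) - s c (f (xs @ a # ys)))"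
    and P: "module.subspace s (Collect P)"
    and p: "p \<in> multilin_rels sV"
  shows "P (lin_ext s f p)"
proof -
  interpret vector_space s by fact
  interpret F: vector_space fscale by (rule vector_space_fscale)
  interpret L: Vector_Spaces.linear fscale s "lin_ext s f" by (rule linear_lin_ext) fact
  have "lin_ext s f p \<in> Collect P"
    using p unfolding multilin_rels_def
  proof (induction rule: F.span_induct)
    case base
    show ?case using L.subspace_vimage[OF P] by (simp add: vimage_def)
  next
    case (step p)
    with assms show ?case
      by (auto simp: L.diff L.scale)
  qed
  then show ?thesis by simp
qed

context tensor_algebra
begin

lemma on_words_mod:
  assumes s: "vector_space s"
    and add: "\<And>xs a b ys. P (f (xs @ (a + b) # ys) - f (xs @ a # ys) - f (xs @ b # ys))"
    and scale: "\<And>xs c a ys. P (f (xs @ sV c a # ys) - s c (f (xs @ a # ys)))"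
    and P: "module.subspace s (Collect P)"
  shows "P (on_words sT \<iota> s f (word \<iota> w) - f w)"
proof -
  interpret L: Vector_Spaces.linear fscale s "lin_ext s f" by (rule linear_lin_ext) fact
  interpret W: Vector_Spaces.linear fscale sT "lin_ext sT (word \<iota>)"
    by (rule linear_lin_ext) unfold_locales
  define p where "p = (SOME p. lin_ext sT (word \<iota>) p = word \<iota> w)"
  have w: "lin_ext sT (word \<iota>) (ten w) = word \<iota> w"
    by (simp add: vs2.vector_space_axioms)
  have "lin_ext sT (word \<iota>) p = word \<iota> w"
    unfolding p_def by (rule someI[where P = "\<lambda>p. lin_ext sT (word \<iota>) p = word \<iota> w"]) (rule w)
  then have "p - ten w \<in> multilin_rels sV"
    using w by (simp add: W.diff flip: words_kernel)
  from lin_ext_rels[OF s add scale P this] show ?thesis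
    using s by (simp add: on_words_def p_def L.diff L.vs2.scale_one)
qed

lemma on_words_word:
  assumes s: "vector_space s"
    and add: "\<And>xs a b ys. f (xs @ (a + b) # ys) = f (xs @ a # ys) + f (xs @ b # ys)"
    and scale: "\<And>xs c a ys. f (xs @ sV c a # ys) = s c (f (xs @ a # ys))"
  shows "on_words sT \<iota> s f (word \<iota> w) = f w"
proof -
  interpret S: vector_space s by fact
  have "on_words sT \<iota> s f (word \<iota> w) - f w = 0"
    by (rule on_words_mod[where P = "\<lambda>x. x = 0"]) (auto simp: s add scale S.subspace_def)
  then show ?thesis by simp
qed

lemma counit_word: "counit sT \<iota> (word \<iota> w) = (if w = [] then 1 else 0)"
  unfolding counit_def by (rule on_words_word) (auto intro!: vector_space.intro simp: algebra_simps)


lemma word_simps: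
  "word \<iota> [] = 1"
  "word \<iota> (a # w) = \<iota> a * word \<iota> w"
  "word \<iota> (v @ w) = word \<iota> v * word \<iota> w"
  by (simp_all add: word_def)

lemma word_multilinear:
  "word \<iota> (xs @ (a + b) # ys) = word \<iota> (xs @ a # ys) + word \<iota> (xs @ b # ys)"
  "word \<iota> (xs @ sV c a # ys) = sT c (word \<iota> (xs @ a # ys))"
  by (simp_all add: word_simps add scale mult_scale algebra_simps)

abbreviation shuffle_sum :: "'v list \<Rightarrow> 'v list \<Rightarrow> 't"
  where "shuffle_sum u v \<equiv> \<Sum>w\<leftarrow>shuffle_list u v. word \<iota> w"

lemma shuffle_sum_simps:
  "shuffle_sum [] v = word \<iota> v"
  "shuffle_sum u [] = word \<iota> u"
  "shuffle_sum (a # u) (b # v) = \<iota> a * shuffle_sum u (b # v) + \<iota> b * shuffle_sum (a # u) v"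
proof -
  show "shuffle_sum u [] = word \<iota> u" by (cases u) simp_all
qed (simp_all add: comp_def word_simps sum_list_const_mult)

lemma shuffle_sum_commute: "shuffle_sum u v = shuffle_sum v u"
proof (induction u v rule: shuffle_list.induct)
  case (3 a u b v)
  then show ?case
    unfolding shuffle_sum_simps by (metis add.commute)
qed (simp_all only: shuffle_sum_simps)

lemma shuffle_sum_add_right:
  "shuffle_sum u (xs @ (a + b) # ys) = shuffle_sum u (xs @ a # ys) + shuffle_sum u (xs @ b # ys)"
proof (induction u arbitrary: xs)
  case Nil
  show ?case by (simp add: shuffle_sum_simps word_multilinear del: shuffle_list.simps)
next
  case (Cons c u)
  note IH = Cons
  show ?case
  proof (induction xs)
    case Nil
    show ?case using IH[of "[]"]
      by (simp add: shuffle_sum_simps add algebra_simps del: shuffle_list.simps)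
  next
    case (Cons d xs)
    then show ?case using IH[of "d # xs"]
      by (simp add: shuffle_sum_simps algebra_simps del: shuffle_list.simps)
  qed
qed

lemma shuffle_sum_scale_right:
  "shuffle_sum u (xs @ sV c a # ys) = sT c (shuffle_sum u (xs @ a # ys))"
proof (induction u arbitrary: xs)
  case Nil
  show ?case by (simp add: shuffle_sum_simps word_multilinear del: shuffle_list.simps)
next
  case (Cons d u)
  note IH = Cons
  show ?case
  proof (induction xs)
    case Nil
    show ?case using IH[of "[]"]
      by (simp add: shuffle_sum_simps scale mult_scale vs2.scale_right_distrib del: shuffle_list.simps)
  next
    case (Cons e xs)
    then show ?case using IH[of "e # xs"]
      by (simp add: shuffle_sum_simps mult_scale vs2.scale_right_distrib del: shuffle_list.simps)
  qed
qed

lemma shuffle_word: "shuffle sT \<iota> (word \<iota> u) (word \<iota> v) = (\<Sum>w\<leftarrow>shuffle_list u v. word \<iota> w)"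
proof -
  have "on_words sT \<iota> sT (\<lambda>v. shuffle_sum u v) (word \<iota> v) = shuffle_sum u v" for u
    by (rule on_words_word)
      (simp_all only: vs2.vector_space_axioms shuffle_sum_add_right shuffle_sum_scale_right)
  moreover have "on_words sT \<iota> sT (\<lambda>u. shuffle_sum u v) (word \<iota> u) = shuffle_sum u v"
    by (rule on_words_word)
      (simp_all only: vs2.vector_space_axioms shuffle_sum_commute[of _ v]
        shuffle_sum_add_right shuffle_sum_scale_right)
  ultimately show ?thesis by (simp add: shuffle_def)
qed

lemma deconc_word:
  "tens_eq sT (tens (deconc sT \<iota> (word \<iota> w)))
    (\<Sum>i\<le>length w. ten [word \<iota> (take i w), word \<iota> (drop i w)])"
proof -
  interpret FS: vector_space "fscale :: 'k \<Rightarrow> ('t \<times> 't \<Rightarrow>\<^sub>0 'k) \<Rightarrow> _" by (rule vector_space_fscale)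
  interpret FL: vector_space "fscale :: 'k \<Rightarrow> ('t list \<Rightarrow>\<^sub>0 'k) \<Rightarrow> _" by (rule vector_space_fscale)
  interpret X: Vector_Spaces.linear fscale fscale "tens :: ('t \<times> 't \<Rightarrow>\<^sub>0 'k) \<Rightarrow> _"
    using linear_lin_ext[OF vector_space_fscale] by (simp add: tens_def[abs_def] sweedler_def)
  define R where "R = multilin_rels sT"
  have R: "FL.subspace R"
    by (simp add: R_def multilin_rels_def)
  have R_add: "ten (xs @ (a + b) # ys) - ten (xs @ a # ys) - ten (xs @ b # ys) \<in> R"
    for xs a b ys
    unfolding R_def multilin_rels_def by (rule FL.span_base) blast
  have R_scale: "ten (xs @ sT c a # ys) - fscale c (ten (xs @ a # ys)) \<in> R" for xs c a ys
    unfolding R_def multilin_rels_def by (rule FL.span_base) blast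
  let ?g = "\<lambda>i w. Poly_Mapping.single (word \<iota> (take i w), word \<iota> (drop i w)) (1::'k)"
  have tens_single: "tens (Poly_Mapping.single (x, y) (1::'k)) = ten [x, y]" for x y :: 't
    by (simp add: tens_def sweedler_def vector_space_fscale)
  have "tens (deconc sT \<iota> (word \<iota> w) - (\<Sum>i\<le>length w. ?g i w)) \<in> R"
    unfolding deconc_def
  proof (rule on_words_mod[where P = "\<lambda>d. tens d \<in> R"])
    show "vector_space (fscale :: 'k \<Rightarrow> ('t \<times> 't \<Rightarrow>\<^sub>0 'k) \<Rightarrow> _)" by (rule vector_space_fscale)
    show "FS.subspace {d. tens d \<in> R}"
      using X.subspace_vimage[OF R] by (simp add: vimage_def)
    fix xs ys :: "'v list" and a b :: 'v and c :: 'k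
    let ?n = "length (xs @ a # ys)"
    have "ten [word \<iota> (take i (xs @ (a + b) # ys)), word \<iota> (drop i (xs @ (a + b) # ys))]
        - ten [word \<iota> (take i (xs @ a # ys)), word \<iota> (drop i (xs @ a # ys))]
        - ten [word \<iota> (take i (xs @ b # ys)), word \<iota> (drop i (xs @ b # ys))] \<in> R" for i
    proof (cases "i \<le> length xs")
      case True
      then show ?thesis
        using R_add[of "[word \<iota> (take i xs)]" _ _ "[]"] by (simp add: word_multilinear)
    next
      case False
      then show ?thesis
        using R_add[of "[]" _ _ "[_]"] by (simp add: word_multilinear take_Cons' drop_Cons')
    qed
    then have "(\<Sum>i\<le>?n. tens (?g i (xs @ (a + b) # ys)) - tens (?g i (xs @ a # ys))
        - tens (?g i (xs @ b # ys))) \<in> R"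
      by (intro FL.subspace_sum[OF R]) (simp add: tens_single)
    then show "tens ((\<Sum>i\<le>length (xs @ (a + b) # ys). ?g i (xs @ (a + b) # ys))
        - (\<Sum>i\<le>length (xs @ a # ys). ?g i (xs @ a # ys))
        - (\<Sum>i\<le>length (xs @ b # ys). ?g i (xs @ b # ys))) \<in> R"
      by (simp only: length_append list.size X.diff X.sum sum_subtractf)
    have "ten [word \<iota> (take i (xs @ sV c a # ys)), word \<iota> (drop i (xs @ sV c a # ys))]
        - fscale c (ten [word \<iota> (take i (xs @ a # ys)), word \<iota> (drop i (xs @ a # ys))]) \<in> R" for i
    proof (cases "i \<le> length xs")
      case True
      then show ?thesis
        using R_scale[of "[word \<iota> (take i xs)]" _ _ "[]"] by (simp add: word_multilinear)
    next
      case False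
      then show ?thesis
        using R_scale[of "[]" _ _ "[_]"] by (simp add: word_multilinear take_Cons' drop_Cons')
    qed
    then have "(\<Sum>i\<le>?n. tens (?g i (xs @ sV c a # ys)) - fscale c (tens (?g i (xs @ a # ys)))) \<in> R"
      by (intro FL.subspace_sum[OF R]) (simp add: tens_single)
    then show "tens ((\<Sum>i\<le>length (xs @ sV c a # ys). ?g i (xs @ sV c a # ys))
        - fscale c (\<Sum>i\<le>length (xs @ a # ys). ?g i (xs @ a # ys))) \<in> R"
      by (simp only: length_append list.size X.diff X.sum X.scale sum_subtractf FL.scale_sum_right)
  qed
  then show ?thesis
    by (simp add: tens_eq_def R_def X.diff X.sum tens_single)
qed

end

section \<open>A model of the tensor algebra\<close>

text \<open>For the vector space with basis \<open>'b\<close>, the monoid algebra of the free monoid on \<open>'b\<close> is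
  a tensor algebra.\<close>

datatype 'b fmon = FMon (letters: "'b list")

instantiation fmon :: (type) monoid_add
begin

definition zero_fmon :: "'a fmon" where "zero_fmon = FMon []"

definition plus_fmon :: "'a fmon \<Rightarrow> 'a fmon \<Rightarrow> 'a fmon"
  where "plus_fmon x y = FMon (letters x @ letters y)"

instance by standard (simp_all add: zero_fmon_def plus_fmon_def)

end

definition free_emb :: "('b \<Rightarrow>\<^sub>0 'k::field) \<Rightarrow> ('b fmon \<Rightarrow>\<^sub>0 'k)"
  where "free_emb = lin_ext fscale (\<lambda>b. Poly_Mapping.single (FMon [b]) 1)"

lemma fscale_single [simp]: "fscale c (Poly_Mapping.single x d) = Poly_Mapping.single x (c * d)"
  by (rule poly_mapping_eqI) (simp add: lookup_single when_def)

lemma fscale_one [simp]: "fscale 1 p = p"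
  by (rule poly_mapping_eqI) simp

lemma poly_mapping_sum_monomials:
  "(\<Sum>x\<in>Poly_Mapping.keys p. Poly_Mapping.single x (Poly_Mapping.lookup p x)) = p"
  by (rule poly_mapping_eqI) (simp add: lookup_sum lookup_single when_def in_keys_iff)

lemma lin_ext_single_id: "lin_ext fscale (\<lambda>x. Poly_Mapping.single x 1) p = p"
  by (simp add: lin_ext_def poly_mapping_sum_monomials)

lemma fscale_conv_mult: "fscale c p = Poly_Mapping.single 0 c * (p :: 'b fmon \<Rightarrow>\<^sub>0 'k::field)"
  by (simp add: fscale_def mult_map_scale_conv_mult)

lemma single_mult_comm:
  "p * Poly_Mapping.single 0 c = Poly_Mapping.single 0 c * (p :: 'b fmon \<Rightarrow>\<^sub>0 'k::field)"
proof -
  have "(\<Sum>m\<in>Poly_Mapping.keys p. Poly_Mapping.single m (Poly_Mapping.lookup p m)) * Poly_Mapping.single 0 c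
    = Poly_Mapping.single 0 c * (\<Sum>m\<in>Poly_Mapping.keys p. Poly_Mapping.single m (Poly_Mapping.lookup p m))"
    by (simp add: sum_distrib_left sum_distrib_right mult_single mult.commute)
  then show ?thesis by (simp add: poly_mapping_sum_monomials)
qed

lemma tensor_algebra_free:
  "tensor_algebra fscale fscale (free_emb :: ('b \<Rightarrow>\<^sub>0 'k::field) \<Rightarrow> _)"
proof -
  let ?\<iota> = "free_emb :: ('b \<Rightarrow>\<^sub>0 'k) \<Rightarrow> _"
  let ?e = "\<lambda>b::'b. Poly_Mapping.single b (1::'k)"
  interpret I: Vector_Spaces.linear fscale fscale ?\<iota>
    unfolding free_emb_def by (rule linear_lin_ext[OF vector_space_fscale])
  interpret W: Vector_Spaces.linear fscale fscale "lin_ext fscale (word ?\<iota>)"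
    by (rule linear_lin_ext[OF vector_space_fscale])
  have mult1: "fscale c x * y = fscale c (x * y)" for c and x y :: "'b fmon \<Rightarrow>\<^sub>0 'k"
    by (simp add: fscale_conv_mult mult.assoc)
  have mult2: "x * fscale c y = fscale c (x * y)" for c and x y :: "'b fmon \<Rightarrow>\<^sub>0 'k"
    by (metis fscale_conv_mult mult.assoc single_mult_comm)
  have word_basis: "word ?\<iota> (map ?e bs) = Poly_Mapping.single (FMon bs) 1" for bs
    by (induction bs)
      (simp_all add: word_def free_emb_def vector_space_fscale mult_single plus_fmon_def
        flip: zero_fmon_def)
  have word_add: "word ?\<iota> (xs @ (a + b) # ys) = word ?\<iota> (xs @ a # ys) + word ?\<iota> (xs @ b # ys)"
    for xs a b ys by (simp add: word_def I.add algebra_simps)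
  have word_scale: "word ?\<iota> (xs @ fscale c a # ys) = fscale c (word ?\<iota> (xs @ a # ys))"
    for xs a c ys by (simp add: word_def I.scale mult1 mult2)
  define E where "E = lin_ext fscale (\<lambda>m. ten (map ?e (letters m)) :: ('b \<Rightarrow>\<^sub>0 'k) list \<Rightarrow>\<^sub>0 'k)"
  interpret E: Vector_Spaces.linear fscale fscale E
    unfolding E_def by (rule linear_lin_ext[OF vector_space_fscale])
  define R where "R = multilin_rels (fscale :: 'k \<Rightarrow> ('b \<Rightarrow>\<^sub>0 'k) \<Rightarrow> _)"
  have R: "W.vs1.subspace R"
    by (simp add: R_def multilin_rels_def)
  have R_add: "ten (xs @ (a + b) # ys) - ten (xs @ a # ys) - ten (xs @ b # ys) \<in> R"
    for xs a b ys
    unfolding R_def multilin_rels_def by (rule W.vs1.span_base) blast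
  have R_scale: "ten (xs @ fscale c a # ys) - fscale c (ten (xs @ a # ys)) \<in> R" for xs c a ys
    unfolding R_def multilin_rels_def by (rule W.vs1.span_base) blast
  have normal_word: "ten (map ?e bs @ w) - E (word ?\<iota> (map ?e bs @ w)) \<in> R" for bs w
  proof (induction w arbitrary: bs)
    case Nil
    show ?case
      using R by (simp add: word_basis E_def vector_space_fscale W.vs1.subspace_0)
  next
    case (Cons v w)
    let ?D = "\<lambda>v. ten (map ?e bs @ v # w) - E (word ?\<iota> (map ?e bs @ v # w))"
    have D_add: "?D (a + b) \<in> R" if "?D a \<in> R" "?D b \<in> R" for a b
    proof -
      have "?D (a + b) = (ten (map ?e bs @ (a + b) # w) - ten (map ?e bs @ a # w)
          - ten (map ?e bs @ b # w)) + (?D a + ?D b)"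
        by (simp add: word_add E.add)
      then show ?thesis
        using that R_add R by (metis W.vs1.subspace_add)
    qed
    have D_scale: "?D (fscale c a) \<in> R" if "?D a \<in> R" for c a
    proof -
      have "?D (fscale c a) = (ten (map ?e bs @ fscale c a # w) - fscale c (ten (map ?e bs @ a # w)))
          + fscale c (?D a)"
        by (simp add: word_scale E.scale W.vs1.scale_right_diff_distrib del: fscale_single)
      then show ?thesis
        using that R_scale R by (metis W.vs1.subspace_add W.vs1.subspace_scale)
    qed
    have D_basis: "?D (?e b) \<in> R" for b
      using Cons.IH[of "bs @ [b]"] by simp
    have D_zero: "?D 0 \<in> R"
      using D_scale[OF D_basis, of 0 undefined] by simp
    have "?D (\<Sum>b\<in>A. fscale (f b) (?e b)) \<in> R" if "finite A" for A f
      using that by induction (use D_zero D_add D_scale D_basis in \<open>auto simp del: fscale_single\<close>)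
    from this[of "Poly_Mapping.keys v" "Poly_Mapping.lookup v"]
    have "?D (lin_ext fscale ?e v) \<in> R" by (simp add: lin_ext_def del: fscale_single)
    then show ?case by (simp add: lin_ext_single_id)
  qed
  have normal: "p - E (lin_ext fscale (word ?\<iota>) p) \<in> R" for p
  proof -
    have "p - E (lin_ext fscale (word ?\<iota>) p) =
      lin_ext fscale ten p - (\<Sum>w\<in>Poly_Mapping.keys p. fscale (Poly_Mapping.lookup p w) (E (word ?\<iota> w)))"
      by (simp add: lin_ext_single_id) (simp add: lin_ext_def E.sum E.scale)
    also have "\<dots> = (\<Sum>w\<in>Poly_Mapping.keys p. fscale (Poly_Mapping.lookup p w) (ten w - E (word ?\<iota> w)))"
      by (simp add: lin_ext_def W.vs1.scale_right_diff_distrib sum_subtractf del: fscale_single)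
    also have "\<dots> \<in> R"
      using R normal_word[of "[]"] by (auto intro!: W.vs1.subspace_sum W.vs1.subspace_scale)
    finally show ?thesis .
  qed
  show ?thesis
  proof unfold_locales
    show "surj (lin_ext fscale (word ?\<iota>))"
    proof (rule surjI)
      fix y
      show "lin_ext fscale (word ?\<iota>) (E y) = y"
      proof -
        have "lin_ext fscale (word ?\<iota>) (E y) =
          (\<Sum>m\<in>Poly_Mapping.keys y. fscale (Poly_Mapping.lookup y m) (Poly_Mapping.single m 1))"
          by (simp add: E_def lin_ext_def[of _ _ y] W.sum W.scale vector_space_fscale word_basis
              del: fscale_single)
        then show ?thesis
          using lin_ext_single_id[of y] by (simp add: lin_ext_def)
      qed
    qed
    show "{p. lin_ext fscale (word ?\<iota>) p = 0} = multilin_rels fscale"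
    proof (intro equalityI subsetI)
      fix p assume "p \<in> {p. lin_ext fscale (word ?\<iota>) p = 0}"
      then show "p \<in> multilin_rels fscale"
        using normal[of p] by (simp add: R_def E.zero)
    next
      fix p assume "p \<in> multilin_rels (fscale :: 'k \<Rightarrow> ('b \<Rightarrow>\<^sub>0 'k) \<Rightarrow> _)"
      then have "lin_ext fscale (word ?\<iota>) p = 0"
        by (rule lin_ext_rels[where P = "\<lambda>x. x = 0", rotated 4])
          (auto simp: vector_space_fscale word_add word_scale I.vs2.subspace_def)
      then show "p \<in> {p. lin_ext fscale (word ?\<iota>) p = 0}" by simp
    qed
  qed (simp_all add: mult1 mult2)
qed

end

theory Submission
  imports Defs
begin

text \<open>Every identity in question is multilinear, and elements of a tensor product over a field are
  separated by multilinear functionals, so everything can be checked on words, where the operations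
  become finite sums over deconcatenations and shuffles. With condition (A) the product is a
  derivation of \<open>\<squnion>\<close>, and this turns the associator into
  \<open>(u \<bullet> v) \<bullet> w - u \<bullet> (v \<bullet> w) = u\<^sup>(\<^sup>1\<^sup>) \<omega>(u\<^sup>(\<^sup>2\<^sup>), w\<^sup>(\<^sup>1\<^sup>)) ((u\<^sup>(\<^sup>3\<^sup>) \<bullet> v) \<squnion> w\<^sup>(\<^sup>2\<^sup>))
  + u\<^sup>(\<^sup>1\<^sup>) \<omega>(u\<^sup>(\<^sup>2\<^sup>), v\<^sup>(\<^sup>1\<^sup>)) ((u\<^sup>(\<^sup>3\<^sup>) \<bullet> w) \<squnion> v\<^sup>(\<^sup>2\<^sup>))
  + u\<^sup>(\<^sup>1\<^sup>) (\<omega>(u\<^sup>(\<^sup>2\<^sup>) \<bullet> v\<^sup>(\<^sup>1\<^sup>), w\<^sup>(\<^sup>1\<^sup>)) - \<omega>(u\<^sup>(\<^sup>2\<^sup>), v\<^sup>(\<^sup>1\<^sup>) \<bullet> w\<^sup>(\<^sup>1\<^sup>))) (u\<^sup>(\<^sup>3\<^sup>) \<squnion> v\<^sup>(\<^sup>2\<^sup>) \<squnion> w\<^sup>(\<^sup>2\<^sup>))\<close>,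
  which is symmetric in \<open>v, w\<close> by condition (B).

  Conversely, let \<open>\<pi> : T(V) \<rightarrow> V\<close> be the projection onto the letters. Applying \<open>\<epsilon> \<otimes> \<epsilon>\<close> to the formula
  for \<open>\<Delta>(u \<bullet> v)\<close> gives \<open>\<epsilon>(u \<bullet> v) = 2 \<epsilon>(u \<bullet> v)\<close>, hence \<open>\<epsilon>(u \<bullet> v) = 0\<close>. Since
  \<open>x = \<epsilon>(x) 1 + \<pi>(x\<^sup>(\<^sup>1\<^sup>)) x\<^sup>(\<^sup>2\<^sup>)\<close> for all \<open>x\<close>, the formula for \<open>\<Delta>(u \<bullet> v)\<close> then determines \<open>\<bullet>\<close>
  from \<open>\<omega> = \<pi> \<circ> \<bullet>\<close> by recursion on the length of \<open>u\<close>.\<close>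

section \<open>Sums over deconcatenations and shuffles of words\<close>

text \<open>The summand takes the two pieces as separate arguments, so that iterated coproducts and
  products become nested sums of one function \<open>f\<close>. Recursion on the word replaces index
  arithmetic by inductions with \<open>f\<close> arbitrary.\<close>

primrec sum_splits :: "'a list \<Rightarrow> ('a list \<Rightarrow> 'a list \<Rightarrow> 'w) \<Rightarrow> 'w::comm_monoid_add" where
  "sum_splits [] f = f [] []"
| "sum_splits (a # w) f = f [] (a # w) + sum_splits w (\<lambda>x y. f (a # x) y)"

definition sum_shuffles :: "'a list \<Rightarrow> 'a list \<Rightarrow> ('a list \<Rightarrow> 'w) \<Rightarrow> 'w::comm_monoid_add"
  where "sum_shuffles u v f = (\<Sum>w\<leftarrow>shuffle_list u v. f w)"

lemma sum_shuffles_simps [simp]: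
  "sum_shuffles [] v f = f v"
  "sum_shuffles u [] f = f u"
  "sum_shuffles (a # u) (b # v) f =
    sum_shuffles u (b # v) (\<lambda>w. f (a # w)) + sum_shuffles (a # u) v (\<lambda>w. f (b # w))"
proof -
  show "sum_shuffles u [] f = f u" by (cases u) (simp_all add: sum_shuffles_def)
qed (simp_all add: sum_shuffles_def comp_def)

lemma sum_splits_conv_sum: "sum_splits w f = (\<Sum>i\<le>length w. f (take i w) (drop i w))"
  by (induction w arbitrary: f) (simp_all add: sum.atMost_Suc_shift del: sum.atMost_Suc)

lemma sum_splits_cong:
  "(\<And>x y. w = x @ y \<Longrightarrow> f x y = g x y) \<Longrightarrow> sum_splits w f = sum_splits w g"
  by (simp add: sum_splits_conv_sum)

lemma length_shuffle_list: "w \<in> set (shuffle_list u v) \<Longrightarrow> length w = length u + length v"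
  by (induction u v arbitrary: w rule: shuffle_list.induct) auto

lemma sum_shuffles_cong:
  "(\<And>w. length w = length u + length v \<Longrightarrow> f w = g w) \<Longrightarrow> sum_shuffles u v f = sum_shuffles u v g"
  by (auto simp: sum_shuffles_def length_shuffle_list intro!: arg_cong[where f = sum_list])

lemma sum_splits_add:
  "sum_splits w (\<lambda>x y. f x y + g x y) = sum_splits w f + sum_splits w g"
  by (simp add: sum_splits_conv_sum sum.distrib)

lemma sum_shuffles_add:
  "sum_shuffles u v (\<lambda>x. f x + g x) = sum_shuffles u v f + sum_shuffles u v g"
  by (simp add: sum_shuffles_def sum_list_addf)

lemma sum_splits_zero [simp]: "sum_splits w (\<lambda>x y. 0) = 0"
  by (simp add: sum_splits_conv_sum)

lemma sum_shuffles_zero [simp]: "sum_shuffles u v (\<lambda>x. 0) = 0"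
  by (simp add: sum_shuffles_def)

lemma sum_splits_additive:
  assumes "\<And>x y. h (x + y) = h x + h y"
  shows "h (sum_splits w f) = sum_splits w (\<lambda>x y. h (f x y))"
  by (induction w arbitrary: f) (simp_all add: assms)

lemma sum_shuffles_additive:
  assumes "\<And>x y. h (x + y) = h x + h y"
  shows "h (sum_shuffles u v f) = sum_shuffles u v (\<lambda>x. h (f x))"
  by (induction u v arbitrary: f rule: shuffle_list.induct) (simp_all add: assms)

lemma sum_splits_swap:
  "sum_splits u (\<lambda>x y. sum_splits v (\<lambda>z w. f x y z w)) =
   sum_splits v (\<lambda>z w. sum_splits u (\<lambda>x y. f x y z w))"
  by (simp add: sum_splits_conv_sum sum.swap[of _ "{..length u}"])

text \<open>A summation over \<open>z\<close> is an additive functional \<open>L\<close> of its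
  summand, and it commutes with the sum over the cuts of a fixed word. It is instantiated with sums
  over shuffles and over the terms of a product.\<close>

lemma functional_sum_splits:
  assumes "\<And>f g. L (\<lambda>z. f z + g z) = L f + L g"
  shows "L (\<lambda>z. sum_splits w (F z)) = sum_splits w (\<lambda>x y. L (\<lambda>z. F z x y))"
  by (induction w arbitrary: F) (simp_all add: assms)

lemma functional_sum_shuffles:
  assumes "\<And>f g. L (\<lambda>z. f z + g z) = L f + L g"
  shows "L (\<lambda>z. sum_shuffles u v (F z)) = sum_shuffles u v (\<lambda>x. L (\<lambda>z. F z x))"
  by (induction u v arbitrary: F rule: shuffle_list.induct) (simp_all add: assms)

lemma sum_shuffles_splits:
  "sum_shuffles u v (\<lambda>z. sum_splits w (F z)) = sum_splits w (\<lambda>x y. sum_shuffles u v (\<lambda>z. F z x y))"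
  by (rule functional_sum_splits[OF sum_shuffles_add])

lemma sum_shuffles_swap:
  "sum_shuffles u v (\<lambda>z. sum_shuffles u' v' (F z)) =
   sum_shuffles u' v' (\<lambda>x. sum_shuffles u v (\<lambda>z. F z x))"
  by (rule functional_sum_shuffles[OF sum_shuffles_add])

text \<open>Both sides run over the factorisations of \<open>w\<close> into three consecutive
  pieces.\<close>

lemma sum_splits_coassoc:
  "sum_splits w (\<lambda>x y. sum_splits x (\<lambda>x1 x2. f x1 x2 y)) =
   sum_splits w (\<lambda>x y. sum_splits y (\<lambda>y1 y2. f x y1 y2))"
  by (induction w arbitrary: f) (simp_all add: sum_splits_add ac_simps)

lemma sum_splits_append_Cons:
  "sum_splits (x @ a # y) f =
   sum_splits x (\<lambda>x1 x2. f x1 (x2 @ a # y)) + sum_splits y (\<lambda>y1 y2. f (x @ a # y1) y2)"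
  by (induction x arbitrary: f) (simp_all add: ac_simps)

lemma sum_shuffles_commute: "sum_shuffles u v f = sum_shuffles v u f"
  by (induction u v arbitrary: f rule: shuffle_list.induct) (simp_all add: ac_simps)

text \<open>The shuffles are sorted by the prefix \<open>u1\<close> of \<open>u\<close> that ends up
  to the left of the marked letter \<open>a\<close>; it mixes with \<open>x\<close>, and the rest of
  \<open>u\<close> mixes with \<open>y\<close>.\<close>

lemma sum_shuffles_append_Cons:
  "sum_shuffles u (x @ a # y) f =
   sum_splits u (\<lambda>u1 u2. sum_shuffles u1 x (\<lambda>z. sum_shuffles u2 y (\<lambda>w. f (z @ a # w))))"
proof (induction u arbitrary: f x)
  case (Cons c u)
  note IH = Cons
  show ?case
  proof (induction x arbitrary: f)
    case Nil
    show ?case using IH[of "[]"] by (simp add: ac_simps)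
  next
    case (Cons b x)
    show ?case using IH[of "b # x"] Cons by (simp add: sum_splits_add ac_simps)
  qed
qed simp

text \<open>Cutting a shuffle cuts both words and leaves a shuffle of the prefixes and one of the
  suffixes. This is the multiplicativity of \<Delta> for \<squnion>.\<close>

lemma sum_splits_shuffles:
  "sum_shuffles u v (\<lambda>w. sum_splits w f) =
   sum_splits u (\<lambda>u1 u2. sum_splits v (\<lambda>v1 v2.
     sum_shuffles u1 v1 (\<lambda>x. sum_shuffles u2 v2 (\<lambda>y. f x y))))"
proof (induction u v arbitrary: f rule: shuffle_list.induct)
  case (3 a u b v)
  then show ?case by (simp add: sum_splits_add sum_shuffles_add ac_simps)
qed simp_all

text \<open>Both sides are sorted by which of the three words supplies the first letter; that word
  becomes shorter, hence the induction on the total length.\<close>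

lemma sum_shuffles_assoc:
  "sum_shuffles u v (\<lambda>x. sum_shuffles x w f) = sum_shuffles v w (\<lambda>x. sum_shuffles u x f)"
proof (induction "length u + length v + length w" arbitrary: u v w f rule: less_induct)
  case less
  show ?case
  proof (cases "u = [] \<or> v = [] \<or> w = []")
    case False
    then obtain a u' b v' c w' where [simp]: "u = a # u'" "v = b # v'" "w = c # w'"
      by (metis neq_Nil_conv)
    have "sum_shuffles (a # u') (b # v') (\<lambda>x. sum_shuffles x (c # w') f) =
      sum_shuffles u' (b # v') (\<lambda>x. sum_shuffles x (c # w') (\<lambda>w. f (a # w))) +
      sum_shuffles (a # u') v' (\<lambda>x. sum_shuffles x (c # w') (\<lambda>w. f (b # w))) +
      sum_shuffles (a # u') (b # v') (\<lambda>x. sum_shuffles x w' (\<lambda>w. f (c # w)))"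
      by (simp add: sum_shuffles_add ac_simps)
    also have "\<dots> = sum_shuffles (b # v') (c # w') (\<lambda>x. sum_shuffles u' x (\<lambda>w. f (a # w))) +
      sum_shuffles v' (c # w') (\<lambda>x. sum_shuffles (a # u') x (\<lambda>w. f (b # w))) +
      sum_shuffles (b # v') w' (\<lambda>x. sum_shuffles (a # u') x (\<lambda>w. f (c # w)))"
      by (subst (1 2 3) less) auto
    also have "\<dots> = sum_shuffles (b # v') (c # w') (\<lambda>x. sum_shuffles (a # u') x f)"
      by (simp add: sum_shuffles_add ac_simps)
    finally show ?thesis by simp
  qed auto
qed

section \<open>Terms of the product of two words and their deconcatenations\<close>

text \<open>A sum of values of \<open>om\<close> may stand as a single letter of a word; additivity
  in each letter exchanges it for a sum of words.\<close>

definition letter_additive :: "('v::ab_group_add list \<Rightarrow> 'w::ab_group_add) \<Rightarrow> bool"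
  where "letter_additive f \<longleftrightarrow>
    (\<forall>xs a b ys. f (xs @ (a + b) # ys) = f (xs @ a # ys) + f (xs @ b # ys))"

text \<open>The terms of \<open>u \<bullet> v\<close> in which \<open>u\<^sup>(\<^sup>1\<^sup>)\<close> is empty.\<close>

definition sum_bullet_head ::
  "('v list \<Rightarrow> 'v list \<Rightarrow> 'v) \<Rightarrow> 'v list \<Rightarrow> 'v list \<Rightarrow> ('v list \<Rightarrow> 'w) \<Rightarrow> 'w::comm_monoid_add"
  where "sum_bullet_head om u v f = sum_splits u (\<lambda>u1 u2. sum_splits v (\<lambda>v1 v2.
    sum_shuffles u2 v2 (\<lambda>w. f (om u1 v1 # w))))"

text \<open>Values of \<open>om\<close> are vectors, hence again letters, so the product of two
  words is a plain sum of words without coefficients, on which \<open>f\<close> is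
  evaluated.\<close>

definition sum_bullet ::
  "('v list \<Rightarrow> 'v list \<Rightarrow> 'v) \<Rightarrow> 'v list \<Rightarrow> 'v list \<Rightarrow> ('v list \<Rightarrow> 'w) \<Rightarrow> 'w::comm_monoid_add"
  where "sum_bullet om u v f = sum_splits u (\<lambda>u1 u2. sum_bullet_head om u2 v (\<lambda>w. f (u1 @ w)))"

lemma sum_bullet_head_add:
  "sum_bullet_head om u v (\<lambda>x. f x + g x) = sum_bullet_head om u v f + sum_bullet_head om u v g"
  by (simp add: sum_bullet_head_def sum_splits_add sum_shuffles_add)

lemma sum_bullet_add:
  "sum_bullet om u v (\<lambda>x. f x + g x) = sum_bullet om u v f + sum_bullet om u v g"
  by (simp add: sum_bullet_def sum_splits_add sum_bullet_head_add)

lemma sum_bullet_splits: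
  "sum_bullet om u v (\<lambda>z. sum_splits w (F z)) = sum_splits w (\<lambda>x y. sum_bullet om u v (\<lambda>z. F z x y))"
  by (rule functional_sum_splits[OF sum_bullet_add])

lemma sum_bullet_shuffles:
  "sum_bullet om u v (\<lambda>z. sum_shuffles x y (F z)) = sum_shuffles x y (\<lambda>w. sum_bullet om u v (\<lambda>z. F z w))"
  by (rule functional_sum_shuffles[OF sum_bullet_add])

lemma sum_bullet_additive:
  assumes "\<And>x y. h (x + y) = h x + h y"
  shows "h (sum_bullet om u v f) = sum_bullet om u v (\<lambda>x. h (f x))"
  by (simp add: sum_bullet_def sum_bullet_head_def sum_splits_additive[of h, OF assms]
      sum_shuffles_additive[of h, OF assms])

lemma sum_bullet_simps:
  "sum_bullet om [] v f = sum_bullet_head om [] v f"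
  "sum_bullet om (a # u) v f = sum_bullet om u v (\<lambda>x. f (a # x)) + sum_bullet_head om (a # u) v f"
  by (simp_all add: sum_bullet_def ac_simps)

text \<open>The created letter comes first. A cut lies either in front of it, which gives the term
  with \<open>f []\<close>, or in the shuffled remainder, where \<open>sum_splits_shuffles\<close>
  cuts both factors; coassociativity regroups the pieces.\<close>

lemma sum_bullet_head_coprod:
  "sum_bullet_head om u v (\<lambda>x. sum_splits x f) = sum_bullet_head om u v (f []) +
   sum_splits u (\<lambda>x y. sum_splits v (\<lambda>z w. sum_bullet_head om x z (\<lambda>a. sum_shuffles y w (f a))))"
proof -
  have "sum_splits u (\<lambda>u1 u2. sum_splits v (\<lambda>v1 v2. sum_shuffles u2 v2 (\<lambda>w.
        sum_splits w (\<lambda>x. f (om u1 v1 # x))))) =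
    sum_splits u (\<lambda>u1 u2. sum_splits u2 (\<lambda>u21 u22. sum_splits v (\<lambda>v1 v2. sum_splits v2 (\<lambda>v21 v22.
      sum_shuffles u21 v21 (\<lambda>x. sum_shuffles u22 v22 (f (om u1 v1 # x)))))))"
    by (simp add: sum_splits_shuffles sum_splits_swap[where v = v])
  also have "\<dots> = sum_splits u (\<lambda>u12 u3. sum_splits u12 (\<lambda>u1 u2.
      sum_splits v (\<lambda>v12 v3. sum_splits v12 (\<lambda>v1 v2.
      sum_shuffles u2 v2 (\<lambda>x. sum_shuffles u3 v3 (f (om u1 v1 # x)))))))"
    by (simp add: sum_splits_coassoc)
  finally show ?thesis
    by (simp add: sum_bullet_head_def sum_splits_add sum_shuffles_add sum_splits_swap[where v = v])
qed

text \<open>This is the formula for \<Delta>(u \<bullet> v): the first sum collects the cuts to the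
  left of the created letter, the second those to its right. The induction peels off the letters of
  \<open>u\<close> in front of the created one.\<close>

lemma sum_bullet_coprod:
  "sum_bullet om u v (\<lambda>x. sum_splits x f) =
   sum_splits u (\<lambda>x y. sum_bullet om y v (f x)) +
   sum_splits u (\<lambda>x y. sum_splits v (\<lambda>z w. sum_bullet om x z (\<lambda>a. sum_shuffles y w (f a))))"
proof (induction u arbitrary: f)
  case Nil
  show ?case by (simp add: sum_bullet_simps sum_bullet_head_coprod)
next
  case (Cons a u)
  show ?case
    by (simp add: sum_bullet_simps sum_bullet_head_coprod sum_bullet_add sum_splits_add Cons ac_simps)
qed

lemma letter_additive_0:
  assumes "letter_additive f"
  shows "f (xs @ 0 # ys) = 0"
  using assms[unfolded letter_additive_def, rule_format, of xs 0 0 ys] by simp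

lemma letter_additive_Cons0: "letter_additive f \<Longrightarrow> f (0 # ys) = 0"
  using letter_additive_0[of f "[]"] by simp

lemma letter_additive_append: "letter_additive f \<Longrightarrow> letter_additive (\<lambda>w. f (x @ w))"
  unfolding letter_additive_def by (metis append.assoc)

lemma letter_additive_Cons_add:
  "letter_additive f \<Longrightarrow> f ((a + b) # ys) = f (a # ys) + f (b # ys)"
  unfolding letter_additive_def by (metis append_Nil)

lemma sum_splits_left_Nil: "sum_splits w (\<lambda>x y. if x = [] then f x y else 0) = f [] w"
  by (cases w) simp_all

section \<open>The derivation property on words\<close>

context
  fixes om :: "'v::ab_group_add list \<Rightarrow> 'v list \<Rightarrow> 'v"
begin

text \<open>Condition (A) on words, where the counit is the indicator of the empty word: for fixed
  \<open>w\<close>, the map \<open>om _ w\<close> is an \<epsilon>-derivation of the shuffle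
  algebra.\<close>

abbreviation "bullet_primitive \<equiv> (\<forall>u v w. sum_shuffles u v (\<lambda>x. om x w) =
  (if u = [] then om v w else 0) + (if v = [] then om u w else 0))"

text \<open>The prefix read by \<open>om\<close> is a shuffle of a prefix of \<open>u\<close> with a
  prefix of \<open>v\<close>. By (A) it contributes only if one of these prefixes is empty, so the
  created letter consumes letters of \<open>u\<close> alone or of \<open>v\<close> alone.\<close>

lemma sum_shuffles_bullet_head:
  assumes om: bullet_primitive and f: "letter_additive f"
  shows "sum_shuffles u v (\<lambda>x. sum_bullet_head om x w f) =
    sum_splits u (\<lambda>p q. sum_splits w (\<lambda>r s. sum_shuffles q s (\<lambda>m.
      sum_shuffles m v (\<lambda>t. f (om p r # t))))) +
    sum_splits v (\<lambda>p q. sum_splits w (\<lambda>r s. sum_shuffles q s (\<lambda>m.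
      sum_shuffles u m (\<lambda>t. f (om p r # t)))))"
proof -
  \<comment> \<open>The sum over shuffles is moved into the created letter by additivity, where (A)
    evaluates it.\<close>
  have f_om: "sum_shuffles x y (\<lambda>z. f (om z r # t)) =
      (if x = [] then f (om y r # t) else 0) + (if y = [] then f (om x r # t) else 0)" for x y r t
  proof -
    have "sum_shuffles x y (\<lambda>z. f (om z r # t)) = f (sum_shuffles x y (\<lambda>z. om z r) # t)"
      using sum_shuffles_additive[of "\<lambda>a. f (a # t)" x y] letter_additive_Cons_add[OF f] by simp
    then show ?thesis
      using om letter_additive_Cons_add[OF f] letter_additive_Cons0[OF f] by auto
  qed
  let ?A = "\<lambda>u2 v1 v2. sum_splits w (\<lambda>r s. sum_shuffles u2 v2 (\<lambda>y.
    sum_shuffles y s (\<lambda>t. f (om v1 r # t))))"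
  have f_om': "sum_shuffles u1 v1 (\<lambda>x. sum_shuffles u2 v2 (\<lambda>y. sum_shuffles y s (\<lambda>t. f (om x r # t)))) =
      (if u1 = [] then sum_shuffles u2 v2 (\<lambda>y. sum_shuffles y s (\<lambda>t. f (om v1 r # t))) else 0) +
      (if v1 = [] then sum_shuffles u2 v2 (\<lambda>y. sum_shuffles y s (\<lambda>t. f (om u1 r # t))) else 0)"
    for u1 v1 u2 v2 r s
    by (simp only: sum_shuffles_swap[of u1 v1] f_om) (simp add: sum_shuffles_add)
  have "sum_shuffles u v (\<lambda>x. sum_bullet_head om x w f) =
    sum_splits u (\<lambda>u1 u2. sum_splits v (\<lambda>v1 v2. sum_splits w (\<lambda>r s.
      sum_shuffles u1 v1 (\<lambda>x. sum_shuffles u2 v2 (\<lambda>y. sum_shuffles y s (\<lambda>t. f (om x r # t)))))))"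
    by (simp add: sum_bullet_head_def sum_splits_shuffles sum_shuffles_splits)
  also have "\<dots> = sum_splits u (\<lambda>u1 u2. sum_splits v (\<lambda>v1 v2.
      (if u1 = [] then ?A u2 v1 v2 else 0) + (if v1 = [] then ?A u2 u1 v2 else 0)))"
    by (intro sum_splits_cong) (simp add: f_om' sum_splits_add)
  also have "\<dots> = sum_splits v (\<lambda>v1 v2. sum_splits u (\<lambda>u1 u2. if u1 = [] then ?A u2 v1 v2 else 0)) +
      sum_splits u (\<lambda>u1 u2. sum_splits v (\<lambda>v1 v2. if v1 = [] then ?A u2 u1 v2 else 0))"
    by (subst (2) sum_splits_swap) (simp only: sum_splits_add)
  \<comment> \<open>Only the cut with an empty prefix survives, so the word not read by
    \<open>om\<close> enters the shuffle as a whole.\<close>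
  also have "\<dots> = sum_splits v (?A u) + sum_splits u (\<lambda>u1 u2. ?A u2 u1 v)"
    by (simp only: sum_splits_left_Nil)
  also have "sum_splits u (\<lambda>u1 u2. ?A u2 u1 v) = sum_splits u (\<lambda>p q. sum_splits w (\<lambda>r s.
      sum_shuffles q s (\<lambda>m. sum_shuffles m v (\<lambda>t. f (om p r # t)))))"
    by (intro sum_splits_cong)
      (metis sum_shuffles_assoc sum_shuffles_commute)
  also have "sum_splits v (?A u) = sum_splits v (\<lambda>p q. sum_splits w (\<lambda>r s.
      sum_shuffles q s (\<lambda>m. sum_shuffles u m (\<lambda>t. f (om p r # t)))))"
    by (simp add: sum_shuffles_assoc)
  finally show ?thesis by (simp add: ac_simps)
qed

text \<open>The created letter serves as the marked letter of
  \<open>sum_shuffles_append_Cons\<close>, which cuts \<open>v\<close> at its position.\<close>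

lemma sum_bullet_shuffle_left:
  "sum_bullet om u w (\<lambda>x. sum_shuffles v x f) =
   sum_splits u (\<lambda>u1 u2. sum_splits v (\<lambda>v1 v2. sum_shuffles v1 u1 (\<lambda>z.
     sum_splits u2 (\<lambda>p q. sum_splits w (\<lambda>r s. sum_shuffles q s (\<lambda>m.
       sum_shuffles v2 m (\<lambda>t. f (z @ om p r # t))))))))"
  (is "_ = sum_splits u (\<lambda>u1 u2. ?R u1 u2)")
proof -
  have "sum_bullet om u w (\<lambda>x. sum_shuffles v x f) =
    sum_splits u (\<lambda>u1 u2. sum_splits u2 (\<lambda>p q. sum_splits w (\<lambda>r s. sum_shuffles q s (\<lambda>m.
      sum_splits v (\<lambda>v1 v2. sum_shuffles v1 u1 (\<lambda>z.
        sum_shuffles v2 m (\<lambda>t. f (z @ om p r # t))))))))"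
    by (simp add: sum_bullet_def sum_bullet_head_def sum_shuffles_append_Cons)
  also have "\<dots> = sum_splits u ?R"
  proof (intro sum_splits_cong, goal_cases)
    case (1 u1 u2)
    show ?case
      by (simp only: sum_shuffles_swap[of _ u1] sum_shuffles_splits sum_splits_swap[of v])
  qed
  finally show ?thesis .
qed

text \<open>All three expressions are sorted by the position of the created letter: what precedes it
  is a shuffle of prefixes of \<open>u\<close> and \<open>v\<close>, and
  \<open>sum_shuffles_bullet_head\<close> decides which of the two remaining words it
  consumes.\<close>

lemma sum_bullet_leibniz:
  assumes "bullet_primitive" "letter_additive f"
  shows "sum_shuffles u v (\<lambda>x. sum_bullet om x w f) =
    sum_bullet om u w (\<lambda>x. sum_shuffles x v f) + sum_bullet om v w (\<lambda>x. sum_shuffles u x f)"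
proof -
  have "sum_shuffles u v (\<lambda>x. sum_bullet om x w f) =
    sum_splits u (\<lambda>u1 u2. sum_splits v (\<lambda>v1 v2. sum_shuffles u1 v1 (\<lambda>z.
      sum_splits v2 (\<lambda>p q. sum_splits w (\<lambda>r s. sum_shuffles q s (\<lambda>m.
        sum_shuffles u2 m (\<lambda>t. f (z @ om p r # t)))))))) +
    sum_splits u (\<lambda>u1 u2. sum_splits v (\<lambda>v1 v2. sum_shuffles u1 v1 (\<lambda>z.
      sum_splits u2 (\<lambda>p q. sum_splits w (\<lambda>r s. sum_shuffles q s (\<lambda>m.
        sum_shuffles m v2 (\<lambda>t. f (z @ om p r # t))))))))"
    by (simp add: sum_bullet_def sum_splits_shuffles sum_shuffles_add sum_splits_add
        sum_shuffles_bullet_head[OF assms(1) letter_additive_append[OF assms(2)]] ac_simps)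
  also have "sum_splits u (\<lambda>u1 u2. sum_splits v (\<lambda>v1 v2. sum_shuffles u1 v1 (\<lambda>z.
      sum_splits v2 (\<lambda>p q. sum_splits w (\<lambda>r s. sum_shuffles q s (\<lambda>m.
        sum_shuffles u2 m (\<lambda>t. f (z @ om p r # t)))))))) =
    sum_bullet om v w (\<lambda>x. sum_shuffles u x f)"
    by (subst sum_splits_swap) (simp only: sum_bullet_shuffle_left)
  also have "sum_splits u (\<lambda>u1 u2. sum_splits v (\<lambda>v1 v2. sum_shuffles u1 v1 (\<lambda>z.
      sum_splits u2 (\<lambda>p q. sum_splits w (\<lambda>r s. sum_shuffles q s (\<lambda>m.
        sum_shuffles m v2 (\<lambda>t. f (z @ om p r # t)))))))) =
    sum_bullet om u w (\<lambda>x. sum_shuffles v x f)"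
    unfolding sum_bullet_shuffle_left
    by (intro sum_splits_cong) (simp only: sum_shuffles_commute[of _ "_::'v list"])
  finally show ?thesis by (simp add: sum_shuffles_commute[of _ v] ac_simps)
qed

text \<open>The terms of \<open>(u \<bullet> v) \<bullet> w\<close> in which the letter created by \<open>w\<close> is to the right of
  the one created by \<open>v\<close>.\<close>

lemma sum_bullet_bullet_right:
  "sum_splits u (\<lambda>a b. sum_splits v (\<lambda>c d. sum_bullet om a c (\<lambda>z. sum_shuffles b d (\<lambda>y.
     sum_bullet_head om y w (\<lambda>t. f (z @ t)))))) =
   sum_splits u (\<lambda>a b. sum_splits b (\<lambda>p q. sum_splits v (\<lambda>r s. sum_shuffles q s (\<lambda>x.
     sum_bullet om x w (\<lambda>t. f (a @ om p r # t))))))"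
proof -
  \<comment> \<open>The word \<open>m\<close> stands between the two created letters;
    \<open>t\<close> begins with the letter created by \<open>w\<close>.\<close>
  let ?F = "\<lambda>a p q b r s d. sum_shuffles q s (\<lambda>m. sum_shuffles b d (\<lambda>y.
     sum_bullet_head om y w (\<lambda>t. f (a @ om p r # m @ t))))"
  have "sum_splits u (\<lambda>a b. sum_splits v (\<lambda>c d. sum_bullet om a c (\<lambda>z. sum_shuffles b d (\<lambda>y.
     sum_bullet_head om y w (\<lambda>t. f (z @ t)))))) =
    sum_splits u (\<lambda>a' b. sum_splits a' (\<lambda>a c. sum_splits c (\<lambda>p q.
      sum_splits v (\<lambda>v1 d. sum_splits v1 (\<lambda>r s. ?F a p q b r s d)))))"
    by (simp add: sum_bullet_def sum_bullet_head_def[of _ _ "_ :: 'v list" "\<lambda>w. sum_shuffles _ _ (F w)" for F]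
       sum_splits_swap[of v])
  \<comment> \<open>The pieces of \<open>u\<close> and \<open>v\<close> are now cut off from the
    left, so that \<open>q\<close>, \<open>b\<close> and \<open>s\<close>, \<open>d\<close>
    recombine into the two words that are shuffled before \<open>w\<close> acts.\<close>
  also have "\<dots> = sum_splits u (\<lambda>a b'. sum_splits b' (\<lambda>p c. sum_splits c (\<lambda>q b.
      sum_splits v (\<lambda>r v2. sum_splits v2 (\<lambda>s d. ?F a p q b r s d)))))"
    by (simp only: sum_splits_coassoc)
  also have "\<dots> = sum_splits u (\<lambda>a b. sum_splits b (\<lambda>p q. sum_splits v (\<lambda>r s. sum_shuffles q s (\<lambda>x.
     sum_bullet om x w (\<lambda>t. f (a @ om p r # t))))))"
    by (simp add: sum_bullet_def sum_splits_shuffles sum_splits_swap[of v])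
  finally show ?thesis .
qed

end

section \<open>The pre-Lie identity on words\<close>

context
  fixes om :: "'v::ab_group_add list \<Rightarrow> 'v list \<Rightarrow> 'v"
begin

text \<open>The four sums record where the letter created by \<open>w\<close> sits: in the first it
  precedes the letter created by \<open>v\<close>, in the second it consumes that letter, in the
  last two it follows it. The last two come from the derivation property applied to the shuffled
  remainder.\<close>

lemma sum_bullet_bullet_left_arg:
  fixes f :: "'v list \<Rightarrow> 'w::ab_group_add"
  assumes "bullet_primitive om" and f: "letter_additive f"
  shows "sum_bullet om u v (\<lambda>x. sum_bullet om x w f) =
    sum_splits u (\<lambda>a b. sum_splits b (\<lambda>p q. sum_splits w (\<lambda>r s. sum_bullet om q v (\<lambda>z.
      sum_shuffles z s (\<lambda>t. f (a @ om p r # t)))))) +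
    sum_splits u (\<lambda>a b. sum_splits b (\<lambda>p q. sum_splits v (\<lambda>c d. sum_splits w (\<lambda>r s.
      sum_bullet om p c (\<lambda>z. sum_shuffles q d (\<lambda>m. sum_shuffles m s (\<lambda>t. f (a @ om z r # t)))))))) +
    sum_splits u (\<lambda>a b. sum_splits b (\<lambda>p q. sum_splits v (\<lambda>r s. sum_bullet om q w (\<lambda>z.
      sum_shuffles z s (\<lambda>t. f (a @ om p r # t)))))) +
    sum_splits u (\<lambda>a b. sum_splits b (\<lambda>p q. sum_splits v (\<lambda>r s. sum_bullet om s w (\<lambda>z.
      sum_shuffles q z (\<lambda>t. f (a @ om p r # t))))))"
proof -
  have g: "letter_additive (\<lambda>t. f (a @ x # t))" for a x
    using letter_additive_append[OF f, of "a @ [x]"] by simp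
  have "sum_bullet om u v (\<lambda>x. sum_bullet om x w f) =
    sum_splits u (\<lambda>a b. sum_bullet om b v (\<lambda>z. sum_bullet_head om z w (\<lambda>t. f (a @ t)))) +
    sum_splits u (\<lambda>a b. sum_splits b (\<lambda>p q. sum_splits v (\<lambda>r s. sum_shuffles q s (\<lambda>x.
     sum_bullet om x w (\<lambda>t. f (a @ om p r # t))))))"
    unfolding sum_bullet_bullet_right[symmetric]
    by (simp only: sum_bullet_def[of om _ w] sum_bullet_coprod)
  moreover have "sum_bullet om b v (\<lambda>z. sum_bullet_head om z w (\<lambda>t. f (a @ t))) =
    sum_splits b (\<lambda>p q. sum_splits w (\<lambda>r s. sum_bullet om q v (\<lambda>z.
      sum_shuffles z s (\<lambda>t. f (a @ om p r # t))))) +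
    sum_splits b (\<lambda>p q. sum_splits v (\<lambda>c d. sum_splits w (\<lambda>r s.
      sum_bullet om p c (\<lambda>z. sum_shuffles q d (\<lambda>m. sum_shuffles m s (\<lambda>t. f (a @ om z r # t)))))))" for a b
    by (simp only: sum_bullet_head_def[of om _ w] sum_bullet_coprod sum_bullet_splits[of _ _ _ w]
        sum_shuffles_splits[of _ _ w])
  ultimately show ?thesis
    by (simp add: sum_bullet_leibniz[OF assms(1) g] sum_splits_add)
qed

text \<open>The outer created letter consumes a prefix of a term of v \<bullet> w, and
  \<open>sum_bullet_coprod\<close> tells whether this prefix ends before or after the inner created
  letter.\<close>

lemma sum_bullet_bullet_right_arg:
  "sum_bullet om v w (\<lambda>x. sum_bullet om u x f) =
    sum_splits u (\<lambda>a b. sum_splits b (\<lambda>p q. sum_splits v (\<lambda>r s. sum_bullet om s w (\<lambda>z.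
      sum_shuffles q z (\<lambda>t. f (a @ om p r # t)))))) +
    sum_splits u (\<lambda>a b. sum_splits b (\<lambda>p q. sum_splits v (\<lambda>c d. sum_splits w (\<lambda>r s.
      sum_bullet om c r (\<lambda>z. sum_shuffles d s (\<lambda>m. sum_shuffles q m (\<lambda>t. f (a @ om p z # t))))))))"
  by (simp only: sum_bullet_def[of om u] sum_bullet_head_def[of om _ "_ :: 'v list" "\<lambda>w. f (_ @ w)"]
      sum_bullet_splits sum_bullet_coprod sum_splits_add)

lemma sum_bullet_prelie:
  fixes f :: "'v list \<Rightarrow> 'w::ab_group_add"
  assumes A: "bullet_primitive om" and f: "letter_additive f"
    and B: "\<And>u v w. sum_bullet om u v (\<lambda>x. om x w) - sum_bullet om v w (om u) =
      sum_bullet om u w (\<lambda>x. om x v) - sum_bullet om w v (om u)"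
  shows "sum_bullet om u v (\<lambda>x. sum_bullet om x w f) - sum_bullet om v w (\<lambda>x. sum_bullet om u x f) =
    sum_bullet om u w (\<lambda>x. sum_bullet om x v f) - sum_bullet om w v (\<lambda>x. sum_bullet om u x f)"
proof -
  let ?T2 = "\<lambda>a p q c d r s. sum_bullet om p c (\<lambda>z. sum_shuffles q d (\<lambda>m.
    sum_shuffles m s (\<lambda>t. f (a @ om z r # t))))"
  let ?T5 = "\<lambda>a p q c d r s. sum_bullet om c r (\<lambda>z. sum_shuffles d s (\<lambda>m.
    sum_shuffles q m (\<lambda>t. f (a @ om p z # t))))"
  have f_add: "f (a @ (x + y) # t) = f (a @ x # t) + f (a @ y # t)" for a x y t
    using f by (simp add: letter_additive_def)
  have f_sum: "sum_bullet om x y (\<lambda>z. f (a @ g z # t)) = f (a @ sum_bullet om x y g # t)"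
    for x y a g t
    by (rule sum_bullet_additive[symmetric]) (rule f_add)
  \<comment> \<open>For fixed pieces both kinds of terms are words with the same surroundings, and
    they differ only in one letter; (B) is the required identity between these letters.\<close>
  have pointwise: "?T2 a p q c d r s + ?T5 a p q r s c d = ?T2 a p q r s c d + ?T5 a p q c d r s"
    for a p q c d r s
  proof -
    have T2: "?T2 a p q c d r s = sum_shuffles d s (\<lambda>m. sum_shuffles q m (\<lambda>t.
        f (a @ sum_bullet om p c (\<lambda>z. om z r) # t)))" for c d r s
      by (simp only: sum_shuffles_assoc sum_bullet_shuffles f_sum)
    have T5: "?T5 a p q c d r s = sum_shuffles d s (\<lambda>m. sum_shuffles q m (\<lambda>t.
        f (a @ sum_bullet om c r (om p) # t)))" for c d r s
      by (simp only: sum_bullet_shuffles f_sum)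
    have "sum_bullet om p c (\<lambda>z. om z r) + sum_bullet om r c (om p) =
      sum_bullet om p r (\<lambda>z. om z c) + sum_bullet om c r (om p)"
      using B[of p c r] by (simp add: algebra_simps)
    then show ?thesis
      by (simp only: T2 T5 sum_shuffles_commute[of s d] flip: sum_shuffles_add f_add)
  qed
  have "sum_splits u (\<lambda>a b. sum_splits b (\<lambda>p q. sum_splits v (\<lambda>c d. sum_splits w (\<lambda>r s. ?T2 a p q c d r s)))) +
      sum_splits u (\<lambda>a b. sum_splits b (\<lambda>p q. sum_splits w (\<lambda>c d. sum_splits v (\<lambda>r s. ?T5 a p q c d r s)))) =
    sum_splits u (\<lambda>a b. sum_splits b (\<lambda>p q. sum_splits w (\<lambda>c d. sum_splits v (\<lambda>r s. ?T2 a p q c d r s)))) +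
      sum_splits u (\<lambda>a b. sum_splits b (\<lambda>p q. sum_splits v (\<lambda>c d. sum_splits w (\<lambda>r s. ?T5 a p q c d r s))))"
    by (simp only: sum_splits_swap[of w v] pointwise flip: sum_splits_add)
  \<comment> \<open>The fourth sum of the left nesting cancels against the first of the right
    nesting, and the first and third sums are interchanged by swapping \<open>v\<close> and
    \<open>w\<close>. What remains is the identity just proved.\<close>
  then show ?thesis
    unfolding sum_bullet_bullet_left_arg[OF A f] sum_bullet_bullet_right_arg
    by (simp add: algebra_simps)
qed

end

section \<open>Linear maps and tensors over a field\<close>

lemma bilinear_mapI:
  "(\<And>x. Vector_Spaces.linear s2 s3 (\<lambda>y. B x y)) \<Longrightarrow> (\<And>y. Vector_Spaces.linear s1 s3 (\<lambda>x. B x y)) \<Longrightarrow>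
    bilinear_map s1 s2 s3 B"
  by (simp add: bilinear_map_def)

text \<open>The inner linear map makes this usable as an introduction rule: linearity of a nested
  expression in one variable follows by descending to that variable.\<close>

lemma bilinear_map_linear:
  assumes "bilinear_map s1 s2 s3 B"
  shows bilinear_map_left: "Vector_Spaces.linear s s1 f \<Longrightarrow> Vector_Spaces.linear s s3 (\<lambda>x. B (f x) y)"
    and bilinear_map_right: "Vector_Spaces.linear s s2 g \<Longrightarrow> Vector_Spaces.linear s s3 (\<lambda>x. B y (g x))"
  using assms by (simp_all add: bilinear_map_def Vector_Spaces.linear_iff)

lemma linear_map_id: "vector_space s \<Longrightarrow> Vector_Spaces.linear s s (\<lambda>x. x)"
  by (simp add: Vector_Spaces.linear_iff)

lemma linear_map_comp:
  "Vector_Spaces.linear s2 s3 g \<Longrightarrow> Vector_Spaces.linear s1 s2 f \<Longrightarrow> Vector_Spaces.linear s1 s3 (\<lambda>x. g (f x))"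
  by (simp add: Vector_Spaces.linear_iff)

lemma linear_map_add:
  "Vector_Spaces.linear s1 s2 f \<Longrightarrow> Vector_Spaces.linear s1 s2 g \<Longrightarrow>
    Vector_Spaces.linear s1 s2 (\<lambda>x. f x + g x)"
  by (simp add: Vector_Spaces.linear_iff vector_space_def algebra_simps)

lemma linear_map_diff:
  "Vector_Spaces.linear s1 s2 f \<Longrightarrow> Vector_Spaces.linear s1 s2 g \<Longrightarrow>
    Vector_Spaces.linear s1 s2 (\<lambda>x. f x - g x)"
  by (auto simp: Vector_Spaces.linear_iff module.scale_right_diff_distrib
      module_iff_vector_space algebra_simps)

lemma linear_map_scale_const:
  assumes "Vector_Spaces.linear s1 s2 f"
  shows "Vector_Spaces.linear s1 s2 (\<lambda>x. s2 c (f x))"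
proof -
  interpret V: vector_space s2 using assms by (simp add: Vector_Spaces.linear_iff)
  show ?thesis
    using assms by (simp add: Vector_Spaces.linear_iff V.scale_right_distrib V.scale_left_commute)
qed

lemma linear_map_scale_fun:
  assumes "Vector_Spaces.linear s1 (*) f" "vector_space s2"
  shows "Vector_Spaces.linear s1 s2 (\<lambda>x. s2 (f x) v)"
  using assms by (simp add: Vector_Spaces.linear_iff vector_space_def)

lemma linear_map_zero: "vector_space s1 \<Longrightarrow> vector_space s2 \<Longrightarrow> Vector_Spaces.linear s1 s2 (\<lambda>x. 0)"
  by (simp add: Vector_Spaces.linear_iff module.scale_zero_right module_iff_vector_space)

lemma linear_map_sum:
  assumes "vector_space s1" "vector_space s2" "\<And>i. Vector_Spaces.linear s1 s2 (f i)"
  shows "Vector_Spaces.linear s1 s2 (\<lambda>x. \<Sum>i\<in>A. f i x)"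
  by (induction A rule: infinite_finite_induct) (auto intro: assms linear_map_zero linear_map_add)

text \<open>Linearity in a parameter of the summand with the coproduct held fixed; the companion
  \<open>linear_sweedler_deconc\<close> treats a variable under the coproduct.\<close>

lemma linear_map_sweedler_fun:
  assumes "vector_space s1" "vector_space s2" "\<And>x y. Vector_Spaces.linear s1 s2 (\<lambda>z. E z x y)"
  shows "Vector_Spaces.linear s1 s2 (\<lambda>z. sweedler s2 d (\<lambda>x y. E z x y))"
  unfolding sweedler_def lin_ext_def case_prod_unfold
  by (intro linear_map_sum linear_map_scale_const assms)

lemma linear_map_image_lin_ext:
  assumes "Vector_Spaces.linear s1 s2 h"
  shows "h (lin_ext s1 f p) = lin_ext s2 (\<lambda>x. h (f x)) p"
proof -
  interpret Vector_Spaces.linear s1 s2 h by fact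
  show ?thesis by (simp add: lin_ext_def sum scale)
qed

lemma linear_map_image_sweedler:
  "Vector_Spaces.linear s1 s2 h \<Longrightarrow> h (sweedler s1 d E) = sweedler s2 d (\<lambda>x y. h (E x y))"
  by (simp add: sweedler_def linear_map_image_lin_ext case_prod_unfold)

lemma vector_space_mult: "vector_space ((*) :: 'k::field \<Rightarrow> 'k \<Rightarrow> 'k)"
  by unfold_locales (simp_all add: algebra_simps)

section \<open>Separation of tensors by multilinear maps\<close>

text \<open>A basis of \<open>R\<close> stays independent after adding \<open>x\<close>, so a
  functional may be prescribed as 1 at \<open>x\<close> and 0 on that basis.\<close>

lemma functional_separating_subspace:
  fixes s :: "'k::field \<Rightarrow> 'a::ab_group_add \<Rightarrow> 'a"
  assumes "vector_space s" "module.subspace s R" "x \<notin> R"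
  obtains \<phi> where "Vector_Spaces.linear s (*) \<phi>" "\<And>r. r \<in> R \<Longrightarrow> \<phi> r = 0" "\<phi> x = 1"
proof -
  interpret vector_space_pair s "(*) :: 'k \<Rightarrow> 'k \<Rightarrow> 'k"
    using assms(1) vector_space_mult by (simp add: vector_space_pair_def)
  obtain B where B: "B \<subseteq> R" "vs1.independent B" "R \<subseteq> vs1.span B"
    using vs1.maximal_independent_subset by blast
  have "vs1.span B \<subseteq> R"
    using vs1.span_minimal[OF B(1) assms(2)] .
  then have "vs1.independent (insert x B)"
    using B assms(3) by (intro vs1.independent_insertI) auto
  then obtain \<phi> where \<phi>: "Vector_Spaces.linear s (*) \<phi>"
    "\<forall>b\<in>insert x B. \<phi> b = (if b = x then 1 else 0)"
    using linear_independent_extend[of "insert x B" "\<lambda>b. if b = x then 1 else 0"] by blast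
  interpret \<phi>: Vector_Spaces.linear s "(*)" \<phi> by fact
  have "\<phi> r = 0" if "r \<in> R" for r
  proof -
    have "\<forall>b\<in>B. \<phi> b = 0" using \<phi>(2) B(1) assms(3) by auto
    then show ?thesis
      using \<phi>.eq_0_on_span that B(3) by blast
  qed
  then show ?thesis using that \<phi> by auto
qed

text \<open>One function carries a multilinear map for every length of list, matching
  \<open>multilin_rels\<close>, whose relations cover all tensor powers at once.\<close>

definition list_multilinear ::
  "('k \<Rightarrow> 'a::ab_group_add \<Rightarrow> 'a) \<Rightarrow> ('k \<Rightarrow> 'b::ab_group_add \<Rightarrow> 'b) \<Rightarrow> ('a list \<Rightarrow> 'b) \<Rightarrow> bool"
  where "list_multilinear s s' f \<longleftrightarrow>
    (\<forall>xs a b ys. f (xs @ (a + b) # ys) = f (xs @ a # ys) + f (xs @ b # ys)) \<and>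
    (\<forall>xs c a ys. f (xs @ s c a # ys) = s' c (f (xs @ a # ys)))"

lemma lin_ext_multilin_rels:
  assumes "vector_space s'" "list_multilinear s s' f" "p \<in> multilin_rels s"
  shows "lin_ext s' f p = 0"
proof -
  interpret vector_space s' by fact
  show ?thesis
    using assms(2) by (intro lin_ext_rels[where P = "\<lambda>x. x = 0", OF assms(1) _ _ _ assms(3)])
      (auto simp: list_multilinear_def subspace_def)
qed

lemma tens_eqD:
  assumes "tens_eq s p q" "list_multilinear s s' f" "vector_space s'"
  shows "lin_ext s' f p = lin_ext s' f q"
proof -
  interpret Vector_Spaces.linear fscale s' "lin_ext s' f" by (rule linear_lin_ext) fact
  show ?thesis
    using lin_ext_multilin_rels[OF assms(3,2)] assms(1) diff[of p q] by (auto simp: tens_eq_def)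
qed

text \<open>A functional that kills the relations but not \<open>p - q\<close> would restrict to a
  multilinear map on pure tensors distinguishing \<open>p\<close> from \<open>q\<close>. Thus
  identities between tensors reduce to scalar identities.\<close>

lemma tens_eqI:
  fixes s :: "'k::field \<Rightarrow> 'a::ab_group_add \<Rightarrow> 'a"
  assumes "\<And>f. list_multilinear s (*) f \<Longrightarrow> lin_ext (*) f p = lin_ext (*) f q"
  shows "tens_eq s p q"
proof (rule ccontr)
  interpret F: vector_space "fscale :: 'k \<Rightarrow> ('a list \<Rightarrow>\<^sub>0 'k) \<Rightarrow> _" by (rule vector_space_fscale)
  assume "\<not> tens_eq s p q"
  then have "p - q \<notin> multilin_rels s" by (simp add: tens_eq_def)
  moreover have "F.subspace (multilin_rels s)" by (simp add: multilin_rels_def)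
  ultimately obtain \<phi> where \<phi>: "Vector_Spaces.linear fscale (*) \<phi>"
    "\<And>r. r \<in> multilin_rels s \<Longrightarrow> \<phi> r = 0" "\<phi> (p - q) = 1"
    using functional_separating_subspace[OF vector_space_fscale] by metis
  interpret \<phi>: Vector_Spaces.linear fscale "(*)" \<phi> by fact
  have "ten (xs @ (a + b) # ys) - ten (xs @ a # ys) - ten (xs @ b # ys) \<in> multilin_rels s"
    for xs a b ys
    unfolding multilin_rels_def by (rule F.span_base) blast
  moreover have "ten (xs @ s c a # ys) - fscale c (ten (xs @ a # ys)) \<in> multilin_rels s" for xs c a ys
    unfolding multilin_rels_def by (rule F.span_base) blast
  ultimately have "\<phi> (ten (xs @ (a + b) # ys) - ten (xs @ a # ys) - ten (xs @ b # ys)) = 0"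
    "\<phi> (ten (xs @ s c a # ys) - fscale c (ten (xs @ a # ys))) = 0" for xs a b c ys
    using \<phi>(2) by blast+
  then have "list_multilinear s (*) (\<lambda>xs. \<phi> (ten xs))"
    by (auto simp: list_multilinear_def \<phi>.diff \<phi>.scale diff_diff_eq \<phi>.add simp del: fscale_single)
  then have "lin_ext (*) (\<lambda>xs. \<phi> (ten xs)) p = lin_ext (*) (\<lambda>xs. \<phi> (ten xs)) q"
    by (rule assms)
  moreover have "lin_ext (*) (\<lambda>xs. \<phi> (ten xs)) r = \<phi> r" for r
    using linear_map_image_lin_ext[OF \<phi>(1), of "\<lambda>xs. ten xs" r] by (simp add: lin_ext_single_id)
  ultimately show False
    using \<phi>(3) by (simp add: \<phi>.diff)
qed

lemma list_multilinear_two: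
  assumes "list_multilinear s s' f" "vector_space s" "vector_space s'"
  shows "bilinear_map s s s' (\<lambda>x y. f [x, y])"
proof (rule bilinear_mapI)
  have f: "f (xs @ (a + b) # ys) = f (xs @ a # ys) + f (xs @ b # ys)"
    "f (xs @ s c a # ys) = s' c (f (xs @ a # ys))" for xs a b c ys
    using assms(1) by (auto simp: list_multilinear_def)
  show "Vector_Spaces.linear s s' (\<lambda>y. f [x, y])" for x
    using f[of "[x]" _ _ "[]"] assms(2,3) by (simp add: Vector_Spaces.linear_iff)
  show "Vector_Spaces.linear s s' (\<lambda>x. f [x, y])" for y
    using f[of "[]" _ _ "[y]"] assms(2,3) by (simp add: Vector_Spaces.linear_iff)
qed

lemma list_multilinear_three:
  assumes "list_multilinear s s' f" "vector_space s" "vector_space s'"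
  shows "Vector_Spaces.linear s s' (\<lambda>x. f [x, y, z])" "Vector_Spaces.linear s s' (\<lambda>y. f [x, y, z])"
    "Vector_Spaces.linear s s' (\<lambda>z. f [x, y, z])"
proof -
  have f: "f (xs @ (a + b) # ys) = f (xs @ a # ys) + f (xs @ b # ys)"
    "f (xs @ s c a # ys) = s' c (f (xs @ a # ys))" for xs a b c ys
    using assms(1) by (auto simp: list_multilinear_def)
  show "Vector_Spaces.linear s s' (\<lambda>x. f [x, y, z])"
    using f[of "[]" _ _ "[y, z]"] assms(2,3) by (simp add: Vector_Spaces.linear_iff)
  show "Vector_Spaces.linear s s' (\<lambda>y. f [x, y, z])"
    using f[of "[x]" _ _ "[z]"] assms(2,3) by (simp add: Vector_Spaces.linear_iff)
  show "Vector_Spaces.linear s s' (\<lambda>z. f [x, y, z])"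
    using f[of "[x, y]" _ _ "[]"] assms(2,3) by (simp add: Vector_Spaces.linear_iff)
qed

text \<open>Extension by zero to lists of other lengths allows \<open>tens_eqD\<close> to be applied
  to a bilinear map.\<close>

lemma list_multilinear_of_bilinear:
  assumes "bilinear_map s s s' E"
  shows "list_multilinear s s' (\<lambda>l. if length l = 2 then E (l ! 0) (l ! 1) else 0)"
proof -
  have E: "vector_space s'" "E (a + b) y = E a y + E b y" "E x (a + b) = E x a + E x b"
    "E (s c a) y = s' c (E a y)" "E x (s c a) = s' c (E x a)" for a b c x y
    using assms by (auto simp: bilinear_map_def Vector_Spaces.linear_iff)
  interpret vector_space s' by (rule E)
  have cases2: "length xs + length ys \<noteq> 1 \<or> (\<exists>x. xs = [x] \<and> ys = []) \<or> (\<exists>y. xs = [] \<and> ys = [y])"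
    for xs ys :: "'b list"
    by (cases xs; cases ys) auto
  show ?thesis
    unfolding list_multilinear_def
  proof (intro conjI allI, goal_cases)
    case (1 xs a b ys)
    show ?case using cases2[of xs ys] by (auto simp: E)
  next
    case (2 xs c a ys)
    show ?case using cases2[of xs ys] by (auto simp: E)
  qed
qed

section \<open>The tensor algebra on words\<close>

context tensor_algebra
begin

lemma lin_ext_word_surj: obtains p where "x = lin_ext sT (word \<iota>) p"
  using words_surj by (metis surjD)

lemma vector_spaces [simp]: "vector_space sV" "vector_space sT"
  by unfold_locales

text \<open>The chosen representative and \<open>p\<close> differ by an element of
  \<open>multilin_rels sV\<close>, on which the extension of \<open>f\<close> vanishes.\<close>

lemma on_words_lin_ext:
  assumes "vector_space s" "list_multilinear sV s f"
  shows "on_words sT \<iota> s f (lin_ext sT (word \<iota>) p) = lin_ext s f p"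
proof -
  interpret L: Vector_Spaces.linear fscale s "lin_ext s f" by (rule linear_lin_ext) fact
  interpret W: Vector_Spaces.linear fscale sT "lin_ext sT (word \<iota>)"
    by (rule linear_lin_ext) simp
  define q where "q = (SOME q. lin_ext sT (word \<iota>) q = lin_ext sT (word \<iota>) p)"
  have "lin_ext sT (word \<iota>) q = lin_ext sT (word \<iota>) p"
    unfolding q_def by (rule someI[where P = "\<lambda>q. lin_ext sT (word \<iota>) q = lin_ext sT (word \<iota>) p"]) simp
  then have "q - p \<in> multilin_rels sV"
    by (simp add: W.diff flip: words_kernel)
  from lin_ext_multilin_rels[OF assms this] show ?thesis
    by (simp add: on_words_def q_def L.diff)
qed

lemma on_words_multilinear_word:
  "vector_space s \<Longrightarrow> list_multilinear sV s f \<Longrightarrow> on_words sT \<iota> s f (word \<iota> w) = f w"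
  by (rule on_words_word) (auto simp: list_multilinear_def)

lemma linear_on_words:
  assumes "vector_space s" "list_multilinear sV s f"
  shows "Vector_Spaces.linear sT s (on_words sT \<iota> s f)"
proof -
  interpret L: Vector_Spaces.linear fscale s "lin_ext s f" by (rule linear_lin_ext) fact
  interpret W: Vector_Spaces.linear fscale sT "lin_ext sT (word \<iota>)"
    by (rule linear_lin_ext) simp
  have "on_words sT \<iota> s f (x + y) = on_words sT \<iota> s f x + on_words sT \<iota> s f y" for x y
    using on_words_lin_ext[OF assms]
    by (rule_tac lin_ext_word_surj[of x], rule_tac lin_ext_word_surj[of y]) (simp add: L.add flip: W.add)
  moreover have "on_words sT \<iota> s f (sT c x) = s c (on_words sT \<iota> s f x)" for c x
    using on_words_lin_ext[OF assms]
    by (rule_tac lin_ext_word_surj[of x]) (simp add: L.scale flip: W.scale)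
  ultimately show ?thesis
    using assms by (simp add: Vector_Spaces.linear_iff)
qed

lemma linear_map_eqI:
  assumes "Vector_Spaces.linear sT s f" "Vector_Spaces.linear sT s g"
    and "\<And>w. f (word \<iota> w) = g (word \<iota> w)"
  shows "f x = g x"
  by (rule lin_ext_word_surj[of x])
    (simp add: linear_map_image_lin_ext[OF assms(1)] linear_map_image_lin_ext[OF assms(2)] assms(3))

lemma bilinear_map_eqI:
  assumes "bilinear_map sT sT s f" "bilinear_map sT sT s g"
    and "\<And>u v. f (word \<iota> u) (word \<iota> v) = g (word \<iota> u) (word \<iota> v)"
  shows "f x y = g x y"
proof (rule linear_map_eqI[of s "\<lambda>x. f x y" "\<lambda>x. g x y"])
  fix u
  show "f (word \<iota> u) y = g (word \<iota> u) y"
    by (rule linear_map_eqI) (use assms in \<open>auto simp: bilinear_map_def\<close>)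
qed (use assms in \<open>auto simp: bilinear_map_def\<close>)

text \<open>At every cut the modified letter lies in exactly one of the two pieces, so
  multilinearity of \<open>word \<iota>\<close> and bilinearity of \<open>E\<close> apply term by
  term.\<close>

lemma list_multilinear_sum_splits:
  assumes "bilinear_map sT sT s E"
  shows "list_multilinear sV s (\<lambda>w. sum_splits w (\<lambda>x y. E (word \<iota> x) (word \<iota> y)))"
proof -
  have E: "vector_space s" "E (a + b) y = E a y + E b y" "E x (a + b) = E x a + E x b"
    "E (sT c a) y = s c (E a y)" "E x (sT c a) = s c (E x a)" for a b c x y
    using assms by (auto simp: bilinear_map_def Vector_Spaces.linear_iff)
  interpret S: vector_space s by (rule E)
  show ?thesis
    by (simp add: list_multilinear_def sum_splits_append_Cons word_multilinear E sum_splits_add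
        S.scale_right_distrib sum_splits_additive[of "s _"] ac_simps)
qed

text \<open>Both sides are evaluated at the same chosen representative of \<open>x\<close>, so
  linearity of the extension of \<open>E\<close> suffices.\<close>

lemma sweedler_deconc:
  assumes "vector_space s"
  shows "sweedler s (deconc sT \<iota> x) E =
    on_words sT \<iota> s (\<lambda>w. sum_splits w (\<lambda>x y. E (word \<iota> x) (word \<iota> y))) x"
proof -
  interpret L: Vector_Spaces.linear fscale s "lin_ext s (\<lambda>(x, y). E x y)"
    by (rule linear_lin_ext) fact
  show ?thesis
    by (simp add: sweedler_def deconc_def on_words_def linear_map_image_lin_ext[OF L.linear_axioms]
        L.sum sum_splits_conv_sum assms L.vs2.scale_one)
qed

lemma sweedler_deconc_word:
  assumes "bilinear_map sT sT s E"
  shows "sweedler s (deconc sT \<iota> (word \<iota> w)) E = sum_splits w (\<lambda>x y. E (word \<iota> x) (word \<iota> y))"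
proof -
  have s: "vector_space s" using assms by (simp add: bilinear_map_def Vector_Spaces.linear_iff)
  show ?thesis
    by (simp add: sweedler_deconc[OF s] on_words_multilinear_word[OF s list_multilinear_sum_splits[OF assms]])
qed

lemma linear_sweedler_deconc:
  assumes "bilinear_map sT sT s E" "Vector_Spaces.linear s1 sT f"
  shows "Vector_Spaces.linear s1 s (\<lambda>x. sweedler s (deconc sT \<iota> (f x)) E)"
proof -
  have s: "vector_space s" using assms by (simp add: bilinear_map_def Vector_Spaces.linear_iff)
  show ?thesis
    unfolding sweedler_deconc[OF s]
    by (rule linear_map_comp[OF linear_on_words[OF s list_multilinear_sum_splits[OF assms(1)]] assms(2)])
qed

lemma linear_counit: "Vector_Spaces.linear sT (*) (counit sT \<iota>)"
  unfolding counit_def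
  by (rule linear_on_words) (auto simp: vector_space_mult list_multilinear_def)

lemma shuffle_bilinear: "bilinear_map sT sT sT (shuffle sT \<iota>)"
proof -
  let ?S = "\<lambda>u. on_words sT \<iota> sT (\<lambda>v. shuffle_sum u v)"
  have S: "list_multilinear sV sT (\<lambda>v. shuffle_sum u v)" for u
    by (simp only: list_multilinear_def shuffle_sum_add_right shuffle_sum_scale_right simp_thms)
  have lin_S: "Vector_Spaces.linear sT sT (?S u)" for u
    by (rule linear_on_words[OF _ S]) simp
  \<comment> \<open>The factors are swapped so that the word indexing \<open>?S\<close> becomes the
    right argument, where the multilinearity laws of \<open>shuffle_sum\<close> apply.\<close>
  have S_word: "?S u (word \<iota> v) = shuffle_sum v u" for u v
    by (subst shuffle_sum_commute) (rule on_words_multilinear_word[OF _ S], simp)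
  have mult: "list_multilinear sV sT (\<lambda>u. ?S u y)" for y
    unfolding list_multilinear_def
  proof (intro conjI allI)
    fix xs a b ys c
    show "?S (xs @ (a + b) # ys) y = ?S (xs @ a # ys) y + ?S (xs @ b # ys) y"
      by (rule linear_map_eqI[where s = sT and f = "?S (xs @ (a + b) # ys)"], rule lin_S,
          rule linear_map_add[OF lin_S lin_S]) (simp only: S_word shuffle_sum_add_right)
    show "?S (xs @ sV c a # ys) y = sT c (?S (xs @ a # ys) y)"
      by (rule linear_map_eqI[where s = sT and f = "?S (xs @ sV c a # ys)"], rule lin_S,
          rule linear_map_scale_const[OF lin_S]) (simp only: S_word shuffle_sum_scale_right)
  qed
  show ?thesis
  proof (rule bilinear_mapI)
    fix y
    show "Vector_Spaces.linear sT sT (\<lambda>x. shuffle sT \<iota> x y)"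
      unfolding shuffle_def by (rule linear_on_words[OF _ mult]) simp
  next
    fix x
    \<comment> \<open>A representative of \<open>x\<close> turns the product into a finite
      combination of the maps \<open>?S u\<close>, each linear in \<open>y\<close>.\<close>
    obtain p where p: "x = lin_ext sT (word \<iota>) p" by (rule lin_ext_word_surj)
    show "Vector_Spaces.linear sT sT (\<lambda>y. shuffle sT \<iota> x y)"
      unfolding shuffle_def p on_words_lin_ext[OF vector_spaces(2) mult]
      unfolding lin_ext_def
      by (intro linear_map_sum linear_map_scale_const lin_S) simp_all
  qed
qed

lemma mult_bilinear: "bilinear_map sT sT sT (*)"
  by (rule bilinear_mapI) (simp_all add: Vector_Spaces.linear_iff mult_scale algebra_simps)

lemma linear_shuffle_word:
  assumes "Vector_Spaces.linear sT s f"
  shows "f (shuffle sT \<iota> (word \<iota> u) (word \<iota> v)) = sum_shuffles u v (\<lambda>w. f (word \<iota> w))"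
proof -
  have "shuffle sT \<iota> (word \<iota> u) (word \<iota> v) = sum_shuffles u v (word \<iota>)"
    by (simp only: shuffle_word sum_shuffles_def)
  then show ?thesis
    using sum_shuffles_additive[of f u v "word \<iota>"] assms by (simp add: Vector_Spaces.linear_iff)
qed

lemma linear_iota: "Vector_Spaces.linear sV sT \<iota>"
  by (rule linear_axioms)

end

locale tensor_algebra_bullet = tensor_algebra sV sT \<iota>
  for sV :: "'k::field \<Rightarrow> 'v::ab_group_add \<Rightarrow> 'v"
    and sT :: "'k \<Rightarrow> 't::ring_1 \<Rightarrow> 't"
    and \<iota> :: "'v \<Rightarrow> 't" +
  fixes \<omega> :: "'t \<Rightarrow> 't \<Rightarrow> 'v"
  assumes \<omega>_bilinear: "bilinear_map sT sT sV \<omega>"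
begin

abbreviation "\<omega>_words \<equiv> \<lambda>u v. \<omega> (word \<iota> u) (word \<iota> v)"

lemmas bilinear_rules =
  bilinear_map_left[OF \<omega>_bilinear] bilinear_map_right[OF \<omega>_bilinear]
  bilinear_map_left[OF shuffle_bilinear] bilinear_map_right[OF shuffle_bilinear]
  bilinear_map_left[OF mult_bilinear] bilinear_map_right[OF mult_bilinear]
  linear_map_comp[OF linear_iota] linear_map_sweedler_fun linear_sweedler_deconc bilinear_mapI
  linear_map_id vector_spaces

lemma bullet_bilinear: "bilinear_map sT sT sT (bullet sT \<iota> \<omega>)"
  unfolding bullet_def by (intro bilinear_rules)

lemma bullet_word: "bullet sT \<iota> \<omega> (word \<iota> u) (word \<iota> v) = sum_bullet \<omega>_words u v (word \<iota>)"
proof -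
  have inner: "word \<iota> x * \<iota> a * shuffle sT \<iota> (word \<iota> y) (word \<iota> z) = sum_shuffles y z (\<lambda>t. word \<iota> (x @ a # t))"
    for x a y z
    by (subst linear_shuffle_word[where s = sT and f = "\<lambda>t. word \<iota> x * \<iota> a * t"])
      (auto intro!: bilinear_map_right[OF mult_bilinear] linear_map_id simp: word_simps mult.assoc)
  have "bullet sT \<iota> \<omega> (word \<iota> u) (word \<iota> v) = sum_splits u (\<lambda>u12 u3. sum_splits u12 (\<lambda>u1 u2.
     sum_splits v (\<lambda>v1 v2. word \<iota> u1 * \<iota> (\<omega>_words u2 v1) * shuffle sT \<iota> (word \<iota> u3) (word \<iota> v2))))"
    unfolding bullet_def
    by (subst sweedler_deconc_word, (intro bilinear_rules)[1])+ simp
  \<comment> \<open>\<open>bullet\<close> cuts the left piece of \<open>u\<close> a second time,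
    \<open>sum_bullet\<close> the right piece; coassociativity reconciles them.\<close>
  then show ?thesis
    by (simp add: inner sum_bullet_def sum_bullet_head_def sum_splits_coassoc)
qed

lemma linear_bullet_word:
  assumes "Vector_Spaces.linear sT s f"
  shows "f (bullet sT \<iota> \<omega> (word \<iota> u) (word \<iota> v)) = sum_bullet \<omega>_words u v (\<lambda>w. f (word \<iota> w))"
  using sum_bullet_additive[of f \<omega>_words u v "word \<iota>"] assms
  by (simp add: bullet_word Vector_Spaces.linear_iff)

end

section \<open>The shuffle bialgebra\<close>

lemma sum_splits_right_Nil: "sum_splits w (\<lambda>x y. if y = [] then f x y else 0) = f w []"
  by (induction w arbitrary: f) simp_all

context tensor_algebra
begin

lemmas linear_rules =
  bilinear_map_left[OF shuffle_bilinear] bilinear_map_right[OF shuffle_bilinear]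
  linear_map_sweedler_fun linear_sweedler_deconc bilinear_mapI linear_map_id vector_spaces
  vector_space_mult linear_map_add linear_map_diff

lemma trilinear_map_eqI:
  assumes "\<And>y z. Vector_Spaces.linear sT s (\<lambda>x. f x y z)" "\<And>y z. Vector_Spaces.linear sT s (\<lambda>x. g x y z)"
    and "\<And>x z. Vector_Spaces.linear sT s (\<lambda>y. f x y z)" "\<And>x z. Vector_Spaces.linear sT s (\<lambda>y. g x y z)"
    and "\<And>x y. Vector_Spaces.linear sT s (\<lambda>z. f x y z)" "\<And>x y. Vector_Spaces.linear sT s (\<lambda>z. g x y z)"
    and "\<And>u v w. f (word \<iota> u) (word \<iota> v) (word \<iota> w) = g (word \<iota> u) (word \<iota> v) (word \<iota> w)"
  shows "f x y z = g x y z"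
proof (rule linear_map_eqI[of s "\<lambda>x. f x y z" "\<lambda>x. g x y z"])
  show "f (word \<iota> u) y z = g (word \<iota> u) y z" for u
    by (rule bilinear_map_eqI[of s]) (auto intro: bilinear_mapI assms)
qed (rule assms)+

lemma shuffle_words: "shuffle sT \<iota> (word \<iota> u) (word \<iota> v) = sum_shuffles u v (word \<iota>)"
  by (rule linear_shuffle_word[OF linear_map_id]) simp

lemma shuffle_commute: "shuffle sT \<iota> x y = shuffle sT \<iota> y x"
  by (rule bilinear_map_eqI[of sT "shuffle sT \<iota>" "\<lambda>x y. shuffle sT \<iota> y x"])
    ((intro linear_rules)[1], (intro linear_rules)[1], simp add: shuffle_words sum_shuffles_commute)

lemma shuffle_assoc: "shuffle sT \<iota> (shuffle sT \<iota> x y) z = shuffle sT \<iota> x (shuffle sT \<iota> y z)"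
proof (rule trilinear_map_eqI[where s = sT
      and f = "\<lambda>x y z. shuffle sT \<iota> (shuffle sT \<iota> x y) z"
      and g = "\<lambda>x y z. shuffle sT \<iota> x (shuffle sT \<iota> y z)"])
  fix u v w
  have "shuffle sT \<iota> (shuffle sT \<iota> (word \<iota> u) (word \<iota> v)) (word \<iota> w) =
    sum_shuffles u v (\<lambda>x. sum_shuffles x w (word \<iota>))"
    by (subst linear_shuffle_word[where f = "\<lambda>x. shuffle sT \<iota> x (word \<iota> w)" and s = sT])
      (intro linear_rules, simp only: shuffle_words)
  also have "\<dots> = sum_shuffles v w (\<lambda>x. sum_shuffles u x (word \<iota>))"
    by (rule sum_shuffles_assoc)
  also have "\<dots> = shuffle sT \<iota> (word \<iota> u) (shuffle sT \<iota> (word \<iota> v) (word \<iota> w))"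
    by (subst linear_shuffle_word[where f = "shuffle sT \<iota> (word \<iota> u)" and s = sT])
      (intro linear_rules, simp only: shuffle_words)
  finally show "shuffle sT \<iota> (shuffle sT \<iota> (word \<iota> u) (word \<iota> v)) (word \<iota> w) =
    shuffle sT \<iota> (word \<iota> u) (shuffle sT \<iota> (word \<iota> v) (word \<iota> w))" .
qed (intro linear_rules)+

lemma shuffle_one: "shuffle sT \<iota> 1 x = x" "shuffle sT \<iota> x 1 = x"
proof -
  show "shuffle sT \<iota> 1 x = x" for x
    by (rule linear_map_eqI[of sT "shuffle sT \<iota> 1" "\<lambda>x. x"], (intro linear_rules)[1],
        (intro linear_rules)[1]) (use shuffle_words[of "[]"] in \<open>simp add: word_simps\<close>)
  then show "shuffle sT \<iota> x 1 = x" by (subst shuffle_commute)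
qed

lemma counit_shuffle: "counit sT \<iota> (shuffle sT \<iota> x y) = counit sT \<iota> x * counit sT \<iota> y"
proof (rule bilinear_map_eqI[of "(*)"])
  show "bilinear_map sT sT (*) (\<lambda>x y. counit sT \<iota> (shuffle sT \<iota> x y))"
    by (intro linear_rules linear_map_comp[OF linear_counit])
  show "bilinear_map sT sT (*) (\<lambda>x y. counit sT \<iota> x * counit sT \<iota> y)"
    by (intro linear_rules linear_map_scale_const[of _ "(*)"] linear_map_scale_fun linear_counit)
  fix u v
  \<comment> \<open>The lengths add up in a shuffle, so it is empty only if both words are.\<close>
  have "sum_shuffles u v (\<lambda>w. counit sT \<iota> (word \<iota> w)) = sum_shuffles u v (\<lambda>w. if u = [] \<and> v = [] then 1 else 0)"
    by (rule sum_shuffles_cong) (auto simp: counit_word)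
  then show "counit sT \<iota> (shuffle sT \<iota> (word \<iota> u) (word \<iota> v)) = counit sT \<iota> (word \<iota> u) * counit sT \<iota> (word \<iota> v)"
    by (simp add: linear_shuffle_word[OF linear_counit] counit_word)
qed

lemma sweedler_counit_left: "sweedler sT (deconc sT \<iota> x) (\<lambda>x y. sT (counit sT \<iota> x) y) = x"
proof (rule linear_map_eqI[of sT _ "\<lambda>x. x"])
  have E: "bilinear_map sT sT sT (\<lambda>x y. sT (counit sT \<iota> x) y)"
    by (intro linear_rules linear_map_scale_const linear_map_scale_fun linear_counit)
  then show "Vector_Spaces.linear sT sT (\<lambda>x. sweedler sT (deconc sT \<iota> x) (\<lambda>x y. sT (counit sT \<iota> x) y))"
    by (rule linear_sweedler_deconc[OF _ linear_map_id]) simp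
  show "sweedler sT (deconc sT \<iota> (word \<iota> w)) (\<lambda>x y. sT (counit sT \<iota> x) y) = word \<iota> w" for w
    by (simp add: sweedler_deconc_word[OF E] counit_word if_distrib[of "\<lambda>c. sT c _"]
        sum_splits_left_Nil cong: if_cong)
qed (intro linear_rules)

lemma sweedler_counit_right: "sweedler sT (deconc sT \<iota> x) (\<lambda>x y. sT (counit sT \<iota> y) x) = x"
proof (rule linear_map_eqI[of sT _ "\<lambda>x. x"])
  have E: "bilinear_map sT sT sT (\<lambda>x y. sT (counit sT \<iota> y) x)"
    by (intro linear_rules linear_map_scale_const linear_map_scale_fun linear_counit)
  then show "Vector_Spaces.linear sT sT (\<lambda>x. sweedler sT (deconc sT \<iota> x) (\<lambda>x y. sT (counit sT \<iota> y) x))"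
    by (rule linear_sweedler_deconc[OF _ linear_map_id]) simp
  show "sweedler sT (deconc sT \<iota> (word \<iota> w)) (\<lambda>x y. sT (counit sT \<iota> y) x) = word \<iota> w" for w
    by (simp add: sweedler_deconc_word[OF E] counit_word if_distrib[of "\<lambda>c. sT c _"]
        sum_splits_right_Nil cong: if_cong)
qed (intro linear_rules)

lemma sweedler_coassoc:
  assumes "\<And>y z. Vector_Spaces.linear sT s (\<lambda>x. F x y z)" "\<And>x z. Vector_Spaces.linear sT s (\<lambda>y. F x y z)"
    "\<And>x y. Vector_Spaces.linear sT s (\<lambda>z. F x y z)"
  shows "sweedler s (deconc sT \<iota> a) (\<lambda>x y. sweedler s (deconc sT \<iota> x) (\<lambda>x1 x2. F x1 x2 y)) =
    sweedler s (deconc sT \<iota> a) (\<lambda>x y. sweedler s (deconc sT \<iota> y) (\<lambda>y1 y2. F x y1 y2))"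
proof (rule linear_map_eqI[where s = s
      and f = "\<lambda>a. sweedler s (deconc sT \<iota> a) (\<lambda>x y. sweedler s (deconc sT \<iota> x) (\<lambda>x1 x2. F x1 x2 y))"
      and g = "\<lambda>a. sweedler s (deconc sT \<iota> a) (\<lambda>x y. sweedler s (deconc sT \<iota> y) (\<lambda>y1 y2. F x y1 y2))"])
  have s: "vector_space s" using assms(1) by (simp add: Vector_Spaces.linear_iff)
  note rules = linear_rules s assms
  show "Vector_Spaces.linear sT s (\<lambda>a. sweedler s (deconc sT \<iota> a)
      (\<lambda>x y. sweedler s (deconc sT \<iota> x) (\<lambda>x1 x2. F x1 x2 y)))"
    by (intro rules)
  show "Vector_Spaces.linear sT s (\<lambda>a. sweedler s (deconc sT \<iota> a)
      (\<lambda>x y. sweedler s (deconc sT \<iota> y) (\<lambda>y1 y2. F x y1 y2)))"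
    by (intro rules)
  show "sweedler s (deconc sT \<iota> (word \<iota> w)) (\<lambda>x y. sweedler s (deconc sT \<iota> x) (\<lambda>x1 x2. F x1 x2 y)) =
    sweedler s (deconc sT \<iota> (word \<iota> w)) (\<lambda>x y. sweedler s (deconc sT \<iota> y) (\<lambda>y1 y2. F x y1 y2))" for w
    by ((subst sweedler_deconc_word, (intro rules)[1])+) (rule sum_splits_coassoc)
qed

text \<open>Multiplicativity of \<Delta> tested against a bilinear map; this is the form to which
  \<open>tens_eqI\<close> reduces the bialgebra axiom.\<close>

lemma sweedler_shuffle:
  assumes "bilinear_map sT sT s E"
  shows "sweedler s (deconc sT \<iota> (shuffle sT \<iota> a b)) E =
    sweedler s (deconc sT \<iota> a) (\<lambda>x y. sweedler s (deconc sT \<iota> b)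
      (\<lambda>z w. E (shuffle sT \<iota> x z) (shuffle sT \<iota> y w)))"
proof (rule bilinear_map_eqI[where s = s
      and f = "\<lambda>a b. sweedler s (deconc sT \<iota> (shuffle sT \<iota> a b)) E"
      and g = "\<lambda>a b. sweedler s (deconc sT \<iota> a) (\<lambda>x y. sweedler s (deconc sT \<iota> b)
        (\<lambda>z w. E (shuffle sT \<iota> x z) (shuffle sT \<iota> y w)))"])
  have s: "vector_space s" using assms by (simp add: bilinear_map_def Vector_Spaces.linear_iff)
  note rules = linear_rules s bilinear_map_left[OF assms] bilinear_map_right[OF assms]
  have S: "Vector_Spaces.linear sT s (\<lambda>x. sweedler s (deconc sT \<iota> x) E)"
    by (intro rules assms)
  show "bilinear_map sT sT s (\<lambda>a b. sweedler s (deconc sT \<iota> (shuffle sT \<iota> a b)) E)"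
    by (intro rules assms)
  show "bilinear_map sT sT s (\<lambda>a b. sweedler s (deconc sT \<iota> a) (\<lambda>x y. sweedler s (deconc sT \<iota> b)
      (\<lambda>z w. E (shuffle sT \<iota> x z) (shuffle sT \<iota> y w))))"
    by (intro rules)
  fix u v
  have E: "E (shuffle sT \<iota> (word \<iota> x) (word \<iota> z)) (shuffle sT \<iota> (word \<iota> y) (word \<iota> w)) =
      sum_shuffles x z (\<lambda>p. sum_shuffles y w (\<lambda>q. E (word \<iota> p) (word \<iota> q)))" for x y z w
    by (subst linear_shuffle_word[where f = "\<lambda>x. E x _" and s = s], (intro rules)[1],
        subst linear_shuffle_word[where f = "E _" and s = s], (intro rules)[1]) simp
  show "sweedler s (deconc sT \<iota> (shuffle sT \<iota> (word \<iota> u) (word \<iota> v))) E =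
    sweedler s (deconc sT \<iota> (word \<iota> u)) (\<lambda>x y. sweedler s (deconc sT \<iota> (word \<iota> v))
      (\<lambda>z w. E (shuffle sT \<iota> x z) (shuffle sT \<iota> y w)))"
    by (subst linear_shuffle_word[OF S], (subst sweedler_deconc_word, (intro rules assms)[1])+)
      (simp only: E sum_splits_shuffles)
qed

lemma lin_ext_sweedler_ten: "vector_space s \<Longrightarrow>
    lin_ext s f (sweedler fscale d G) = sweedler s d (\<lambda>x y. lin_ext s f (G x y))"
  by (rule linear_map_image_sweedler) (rule linear_lin_ext)

lemma bialgebra_shuffle: "bialgebra_on sT (shuffle sT \<iota>) 1 (deconc sT \<iota>) (counit sT \<iota>)"
proof (intro bialgebra_on.intro bialgebra_on_axioms.intro)
  fix a b c :: 't and r :: 'k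
  note simps = tens_def lin_ext_sweedler_ten vector_space_mult
    Vector_Spaces.linear.axioms(3)[OF linear_lin_ext, THEN module_hom.add]
    Vector_Spaces.linear.axioms(3)[OF linear_lin_ext, THEN module_hom.scale]
  note f2 = list_multilinear_two[OF _ vector_spaces(2) vector_space_mult]
  note f3 = list_multilinear_three[OF _ vector_spaces(2) vector_space_mult]
  note S = linear_sweedler_deconc[OF f2 linear_map_id[OF vector_spaces(2)]]
  show "tens_eq sT (tens (deconc sT \<iota> (a + b))) (tens (deconc sT \<iota> a) + tens (deconc sT \<iota> b))"
    by (rule tens_eqI) (use S in \<open>simp add: simps Vector_Spaces.linear_iff\<close>)
  show "tens_eq sT (tens (deconc sT \<iota> (sT r a))) (fscale r (tens (deconc sT \<iota> a)))"
    by (rule tens_eqI) (use S in \<open>simp add: simps Vector_Spaces.linear_iff\<close>)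
  show "tens_eq sT
      (sweedler fscale (deconc sT \<iota> a) (\<lambda>x y. sweedler fscale (deconc sT \<iota> x) (\<lambda>x1 x2. ten [x1, x2, y])))
      (sweedler fscale (deconc sT \<iota> a) (\<lambda>x y. sweedler fscale (deconc sT \<iota> y) (\<lambda>y1 y2. ten [x, y1, y2])))"
    by (rule tens_eqI) (simp add: simps sweedler_coassoc[of "(*)" "\<lambda>x y z. _ [x, y, z]", OF f3])
  show "tens_eq sT (tens (deconc sT \<iota> (shuffle sT \<iota> a b)))
      (sweedler fscale (deconc sT \<iota> a) (\<lambda>x y. sweedler fscale (deconc sT \<iota> b)
        (\<lambda>z w. ten [shuffle sT \<iota> x z, shuffle sT \<iota> y w])))"
    by (rule tens_eqI) (simp add: simps sweedler_shuffle[OF f2])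
  show "tens_eq sT (tens (deconc sT \<iota> 1)) (ten [1, 1])"
    by (rule tens_eqI) (use sweedler_deconc_word[OF f2, of _ "[]"] in \<open>simp add: simps word_simps\<close>)
  show "counit sT \<iota> 1 = 1"
    using counit_word[of "[]"] by (simp add: word_simps)
qed (rule vector_spaces linear_counit shuffle_bilinear shuffle_assoc shuffle_one sweedler_counit_left sweedler_counit_right
    counit_shuffle)+

end

section \<open>The product associated with a bilinear map\<close>

context tensor_algebra_bullet
begin

lemma \<omega>_words_primitive:
  assumes "cond_A sV sT \<iota> \<omega>"
  shows "bullet_primitive \<omega>_words"
proof (intro allI)
  fix u v w
  have "sum_shuffles u v (\<lambda>x. \<omega>_words x w) = \<omega> (shuffle sT \<iota> (word \<iota> u) (word \<iota> v)) (word \<iota> w)"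
    by (subst linear_shuffle_word[where f = "\<lambda>x. \<omega> x (word \<iota> w)" and s = sV])
      (intro bilinear_rules, simp)
  then show "sum_shuffles u v (\<lambda>x. \<omega>_words x w) =
      (if u = [] then \<omega>_words v w else 0) + (if v = [] then \<omega>_words u w else 0)"
    using assms by (simp add: cond_A_def counit_word)
qed

lemma \<omega>_bullet_word:
  "\<omega> (bullet sT \<iota> \<omega> (word \<iota> u) (word \<iota> v)) (word \<iota> w) = sum_bullet \<omega>_words u v (\<lambda>x. \<omega>_words x w)"
  "\<omega> (word \<iota> w) (bullet sT \<iota> \<omega> (word \<iota> u) (word \<iota> v)) = sum_bullet \<omega>_words u v (\<lambda>x. \<omega>_words w x)"
  by (subst linear_bullet_word[where f = "\<lambda>x. \<omega> x (word \<iota> w)" and s = sV], intro bilinear_rules, simp)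
    (subst linear_bullet_word[where f = "\<lambda>x. \<omega> (word \<iota> w) x" and s = sV], intro bilinear_rules, simp)

lemma letter_additive_word: "letter_additive (word \<iota>)"
  by (simp add: letter_additive_def word_multilinear)

lemmas bullet_rules =
  bilinear_map_left[OF bullet_bilinear] bilinear_map_right[OF bullet_bilinear] linear_rules

lemma bullet_leibniz:
  assumes "cond_A sV sT \<iota> \<omega>"
  shows "bullet sT \<iota> \<omega> (shuffle sT \<iota> x y) z =
    shuffle sT \<iota> (bullet sT \<iota> \<omega> x z) y + shuffle sT \<iota> x (bullet sT \<iota> \<omega> y z)"
proof (rule trilinear_map_eqI[where s = sT
    and f = "\<lambda>x y z. bullet sT \<iota> \<omega> (shuffle sT \<iota> x y) z"
    and g = "\<lambda>x y z. shuffle sT \<iota> (bullet sT \<iota> \<omega> x z) y + shuffle sT \<iota> x (bullet sT \<iota> \<omega> y z)"])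
  fix u v w
  have "bullet sT \<iota> \<omega> (shuffle sT \<iota> (word \<iota> u) (word \<iota> v)) (word \<iota> w) =
      sum_shuffles u v (\<lambda>x. sum_bullet \<omega>_words x w (word \<iota>))"
    by (subst linear_shuffle_word[where f = "\<lambda>x. bullet sT \<iota> \<omega> x (word \<iota> w)" and s = sT])
      (intro bullet_rules, simp add: bullet_word)
  moreover have "shuffle sT \<iota> (bullet sT \<iota> \<omega> (word \<iota> u) (word \<iota> w)) (word \<iota> v) =
      sum_bullet \<omega>_words u w (\<lambda>x. sum_shuffles x v (word \<iota>))"
    by (subst linear_bullet_word[where f = "\<lambda>x. shuffle sT \<iota> x (word \<iota> v)" and s = sT])
      (intro bullet_rules, simp add: shuffle_words)
  moreover have "shuffle sT \<iota> (word \<iota> u) (bullet sT \<iota> \<omega> (word \<iota> v) (word \<iota> w)) =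
      sum_bullet \<omega>_words v w (\<lambda>x. sum_shuffles u x (word \<iota>))"
    by (subst linear_bullet_word[where f = "\<lambda>x. shuffle sT \<iota> (word \<iota> u) x" and s = sT])
      (intro bullet_rules, simp add: shuffle_words)
  ultimately show "bullet sT \<iota> \<omega> (shuffle sT \<iota> (word \<iota> u) (word \<iota> v)) (word \<iota> w) =
    shuffle sT \<iota> (bullet sT \<iota> \<omega> (word \<iota> u) (word \<iota> w)) (word \<iota> v) +
    shuffle sT \<iota> (word \<iota> u) (bullet sT \<iota> \<omega> (word \<iota> v) (word \<iota> w))"
    using sum_bullet_leibniz[OF \<omega>_words_primitive[OF assms] letter_additive_word] by simp
qed (intro bullet_rules)+

lemma bullet_prelie:
  assumes A: "cond_A sV sT \<iota> \<omega>" and B: "cond_B sT \<iota> \<omega>"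
  shows "bullet sT \<iota> \<omega> (bullet sT \<iota> \<omega> x y) z - bullet sT \<iota> \<omega> x (bullet sT \<iota> \<omega> y z) =
    bullet sT \<iota> \<omega> (bullet sT \<iota> \<omega> x z) y - bullet sT \<iota> \<omega> x (bullet sT \<iota> \<omega> z y)"
proof (rule trilinear_map_eqI[where s = sT
    and f = "\<lambda>x y z. bullet sT \<iota> \<omega> (bullet sT \<iota> \<omega> x y) z - bullet sT \<iota> \<omega> x (bullet sT \<iota> \<omega> y z)"
    and g = "\<lambda>x y z. bullet sT \<iota> \<omega> (bullet sT \<iota> \<omega> x z) y - bullet sT \<iota> \<omega> x (bullet sT \<iota> \<omega> z y)"])
  fix u v w
  have left: "bullet sT \<iota> \<omega> (bullet sT \<iota> \<omega> (word \<iota> u) (word \<iota> v)) (word \<iota> w) =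
      sum_bullet \<omega>_words u v (\<lambda>x. sum_bullet \<omega>_words x w (word \<iota>))" for v w
    by (subst linear_bullet_word[where f = "\<lambda>x. bullet sT \<iota> \<omega> x (word \<iota> w)" and s = sT])
      (intro bullet_rules, simp add: bullet_word)
  have right: "bullet sT \<iota> \<omega> (word \<iota> u) (bullet sT \<iota> \<omega> (word \<iota> v) (word \<iota> w)) =
      sum_bullet \<omega>_words v w (\<lambda>x. sum_bullet \<omega>_words u x (word \<iota>))" for v w
    by (subst linear_bullet_word[where f = "\<lambda>x. bullet sT \<iota> \<omega> (word \<iota> u) x" and s = sT])
      (intro bullet_rules, simp add: bullet_word)
  have "sum_bullet \<omega>_words u v (\<lambda>x. \<omega>_words x w) - sum_bullet \<omega>_words v w (\<omega>_words u) =
      sum_bullet \<omega>_words u w (\<lambda>x. \<omega>_words x v) - sum_bullet \<omega>_words w v (\<omega>_words u)" for u v w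
    using B by (simp add: cond_B_def flip: \<omega>_bullet_word)
  from sum_bullet_prelie[OF \<omega>_words_primitive[OF A] letter_additive_word this]
  show "bullet sT \<iota> \<omega> (bullet sT \<iota> \<omega> (word \<iota> u) (word \<iota> v)) (word \<iota> w) -
      bullet sT \<iota> \<omega> (word \<iota> u) (bullet sT \<iota> \<omega> (word \<iota> v) (word \<iota> w)) =
    bullet sT \<iota> \<omega> (bullet sT \<iota> \<omega> (word \<iota> u) (word \<iota> w)) (word \<iota> v) -
      bullet sT \<iota> \<omega> (word \<iota> u) (bullet sT \<iota> \<omega> (word \<iota> w) (word \<iota> v))"
    by (simp only: left right)
qed (intro bullet_rules)+

text \<open>The coproduct formula tested against a bilinear map; on words it is
  \<open>sum_bullet_coprod\<close>.\<close>

lemma sweedler_bullet: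
  assumes "bilinear_map sT sT s E"
  shows "sweedler s (deconc sT \<iota> (bullet sT \<iota> \<omega> a b)) E =
    sweedler s (deconc sT \<iota> a) (\<lambda>x y. E x (bullet sT \<iota> \<omega> y b)) +
    sweedler s (deconc sT \<iota> a) (\<lambda>x y. sweedler s (deconc sT \<iota> b)
      (\<lambda>z w. E (bullet sT \<iota> \<omega> x z) (shuffle sT \<iota> y w)))"
proof (rule bilinear_map_eqI[where s = s
    and f = "\<lambda>a b. sweedler s (deconc sT \<iota> (bullet sT \<iota> \<omega> a b)) E"
    and g = "\<lambda>a b. sweedler s (deconc sT \<iota> a) (\<lambda>x y. E x (bullet sT \<iota> \<omega> y b)) +
      sweedler s (deconc sT \<iota> a) (\<lambda>x y. sweedler s (deconc sT \<iota> b)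
        (\<lambda>z w. E (bullet sT \<iota> \<omega> x z) (shuffle sT \<iota> y w)))"])
  have s: "vector_space s" using assms by (simp add: bilinear_map_def Vector_Spaces.linear_iff)
  note rules = bullet_rules s bilinear_map_left[OF assms] bilinear_map_right[OF assms]
  have S: "Vector_Spaces.linear sT s (\<lambda>x. sweedler s (deconc sT \<iota> x) E)"
    by (intro rules assms)
  show "bilinear_map sT sT s (\<lambda>a b. sweedler s (deconc sT \<iota> (bullet sT \<iota> \<omega> a b)) E)"
    by (intro rules assms)
  show "bilinear_map sT sT s (\<lambda>a b. sweedler s (deconc sT \<iota> a) (\<lambda>x y. E x (bullet sT \<iota> \<omega> y b)) +
      sweedler s (deconc sT \<iota> a) (\<lambda>x y. sweedler s (deconc sT \<iota> b)
        (\<lambda>z w. E (bullet sT \<iota> \<omega> x z) (shuffle sT \<iota> y w))))"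
    by (intro rules)
  fix u v
  have E1: "E (word \<iota> x) (bullet sT \<iota> \<omega> (word \<iota> y) (word \<iota> v)) =
      sum_bullet \<omega>_words y v (\<lambda>q. E (word \<iota> x) (word \<iota> q))" for x y
    by (subst linear_bullet_word[where f = "E _" and s = s], (intro rules)[1]) simp
  have E2: "E (bullet sT \<iota> \<omega> (word \<iota> x) (word \<iota> z)) (shuffle sT \<iota> (word \<iota> y) (word \<iota> w)) =
      sum_bullet \<omega>_words x z (\<lambda>p. sum_shuffles y w (\<lambda>q. E (word \<iota> p) (word \<iota> q)))" for x y z w
    by (subst linear_bullet_word[where f = "\<lambda>x. E x _" and s = s], (intro rules)[1],
        subst linear_shuffle_word[where f = "E _" and s = s], (intro rules)[1]) simp
  show "sweedler s (deconc sT \<iota> (bullet sT \<iota> \<omega> (word \<iota> u) (word \<iota> v))) E =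
    sweedler s (deconc sT \<iota> (word \<iota> u)) (\<lambda>x y. E x (bullet sT \<iota> \<omega> y (word \<iota> v))) +
    sweedler s (deconc sT \<iota> (word \<iota> u)) (\<lambda>x y. sweedler s (deconc sT \<iota> (word \<iota> v))
      (\<lambda>z w. E (bullet sT \<iota> \<omega> x z) (shuffle sT \<iota> y w)))"
    by (subst linear_bullet_word[OF S], (subst sweedler_deconc_word, (intro rules assms)[1])+)
      (simp only: E1 E2 sum_bullet_coprod)
qed

lemma com_prelie_bialgebra_bullet:
  assumes "cond_A sV sT \<iota> \<omega>" "cond_B sT \<iota> \<omega>"
  shows "com_prelie_bialgebra sT (shuffle sT \<iota>) (bullet sT \<iota> \<omega>) (deconc sT \<iota>)"
proof (intro com_prelie_bialgebra.intro com_prelie_bialgebra_axioms.intro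
    unitary_com_prelie_algebra.intro unitary_com_prelie_algebra_axioms.intro
    com_prelie_algebra.intro com_prelie_algebra_axioms.intro)
  show "\<exists>e. \<forall>a. shuffle sT \<iota> e a = a \<and> shuffle sT \<iota> a e = a"
    using shuffle_one by blast
  show "is_bialgebra sT (shuffle sT \<iota>) (deconc sT \<iota>)"
    using bialgebra_shuffle by (auto simp: is_bialgebra_def)
  note simps = tens_def lin_ext_sweedler_ten vector_space_mult
    Vector_Spaces.linear.axioms(3)[OF linear_lin_ext, THEN module_hom.add]
  show "tens_eq sT (tens (deconc sT \<iota> (bullet sT \<iota> \<omega> a b)))
      (sweedler fscale (deconc sT \<iota> a) (\<lambda>x y. ten [x, bullet sT \<iota> \<omega> y b]) +
       sweedler fscale (deconc sT \<iota> a) (\<lambda>x y. sweedler fscale (deconc sT \<iota> b)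
         (\<lambda>z w. ten [bullet sT \<iota> \<omega> x z, shuffle sT \<iota> y w])))" for a b
    by (rule tens_eqI) (simp add: simps
        sweedler_bullet[OF list_multilinear_two[OF _ vector_spaces(2) vector_space_mult]])
qed (rule vector_spaces shuffle_bilinear bullet_bilinear shuffle_assoc shuffle_commute
    bullet_prelie[OF assms] bullet_leibniz[OF assms(1)])+

end

section \<open>Recovering the bilinear map\<close>

definition only_letter :: "'v list \<Rightarrow> 'v::zero"
  where "only_letter w = (if length w = 1 then hd w else 0)"

lemma only_letter_simps [simp]:
  "only_letter [] = 0" "only_letter (a # w) = (if w = [] then a else 0)"
  by (simp_all add: only_letter_def)

lemma only_letter_append_Cons [simp]:
  "only_letter (x @ a # y) = (if x = [] \<and> y = [] then a else 0)"
  by (cases x) simp_all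

lemma sum_splits_only_letter:
  assumes "\<And>y. f 0 y = 0"
  shows "sum_splits w (\<lambda>x y. f (only_letter x) y) = (case w of [] \<Rightarrow> 0 | a # w' \<Rightarrow> f a w')"
  by (cases w) (simp_all add: assms if_distrib[of "\<lambda>z. f z _"] sum_splits_left_Nil cong: if_cong)

lemma sum_shuffles_Nil_only:
  "sum_shuffles u v (\<lambda>w. if w = [] then c else 0) = (if u = [] \<and> v = [] then c else 0)"
proof -
  have "sum_shuffles u v (\<lambda>w. if w = [] then c else 0) =
      sum_shuffles u v (\<lambda>w. if u = [] \<and> v = [] then c else 0)"
    by (rule sum_shuffles_cong) (auto simp flip: length_0_conv)
  then show ?thesis by simp
qed

text \<open>If both words are nonempty, every shuffle has at least two letters and is
  killed.\<close>

lemma sum_shuffles_only_letter: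
  "sum_shuffles u v only_letter =
    (if u = [] then only_letter v else 0) + (if v = [] then only_letter u else (0::'v::comm_monoid_add))"
proof (cases "u = [] \<or> v = []")
  case False
  then obtain a u' b v' where "u = a # u'" "v = b # v'"
    by (meson list.exhaust)
  then have "sum_shuffles u v only_letter = sum_shuffles u v (\<lambda>w. 0::'v)"
    by (intro sum_shuffles_cong) (simp add: only_letter_def)
  then show ?thesis using False by simp
qed auto

text \<open>A term is a single letter only when nothing precedes the created letter and nothing is
  left to shuffle; then all of \<open>u\<close> and \<open>v\<close> has been consumed.\<close>

lemma sum_bullet_only_letter:
  fixes om :: "'v::comm_monoid_add list \<Rightarrow> 'v list \<Rightarrow> 'v"
  shows "sum_bullet om u v only_letter = om u v"
proof -
  have "sum_splits v (\<lambda>v1 v2. if u2 = [] \<and> v2 = [] then om u1 v1 else 0) =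
      (if u2 = [] then om u1 v else 0)" for u1 u2 :: "'v list"
    by (simp add: sum_splits_right_Nil)
  then have "sum_bullet_head om u v (\<lambda>w. only_letter (x @ w)) = (if x = [] then om u v else 0)" for x u
    by (cases "x = []") (simp_all add: sum_bullet_head_def sum_shuffles_Nil_only sum_splits_right_Nil)
  then show ?thesis by (simp add: sum_bullet_def sum_splits_left_Nil)
qed

context tensor_algebra
begin

definition letter_proj :: "'t \<Rightarrow> 'v"
  where "letter_proj = on_words sT \<iota> sV only_letter"

lemma list_multilinear_only_letter: "list_multilinear sV sV only_letter"
  by (simp add: list_multilinear_def)

lemma linear_letter_proj: "Vector_Spaces.linear sT sV letter_proj"
  unfolding letter_proj_def by (rule linear_on_words[OF _ list_multilinear_only_letter]) simp

lemma letter_proj_word: "letter_proj (word \<iota> w) = only_letter w"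
  unfolding letter_proj_def by (rule on_words_multilinear_word[OF _ list_multilinear_only_letter]) simp

lemma letter_proj_shuffle:
  "letter_proj (shuffle sT \<iota> x y) = sV (counit sT \<iota> x) (letter_proj y) + sV (counit sT \<iota> y) (letter_proj x)"
proof (rule bilinear_map_eqI[where s = sV and f = "\<lambda>x y. letter_proj (shuffle sT \<iota> x y)"
    and g = "\<lambda>x y. sV (counit sT \<iota> x) (letter_proj y) + sV (counit sT \<iota> y) (letter_proj x)"])
  show "bilinear_map sT sT sV (\<lambda>x y. letter_proj (shuffle sT \<iota> x y))"
    by (intro linear_rules linear_map_comp[OF linear_letter_proj])
  show "bilinear_map sT sT sV
      (\<lambda>x y. sV (counit sT \<iota> x) (letter_proj y) + sV (counit sT \<iota> y) (letter_proj x))"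
    by (intro bilinear_mapI linear_map_add linear_map_scale_const linear_map_scale_fun
        linear_letter_proj linear_counit vector_spaces)
  show "letter_proj (shuffle sT \<iota> (word \<iota> u) (word \<iota> v)) =
      sV (counit sT \<iota> (word \<iota> u)) (letter_proj (word \<iota> v)) +
      sV (counit sT \<iota> (word \<iota> v)) (letter_proj (word \<iota> u))" for u v
    by (simp add: linear_shuffle_word[OF linear_letter_proj] letter_proj_word
        sum_shuffles_only_letter counit_word)
qed

lemma linear_counit_one: "Vector_Spaces.linear sT sT (\<lambda>x. sT (counit sT \<iota> x) 1)"
  by (intro linear_map_scale_fun linear_counit vector_spaces)

lemma bilinear_letter_proj_mult: "bilinear_map sT sT sT (\<lambda>x y. \<iota> (letter_proj x) * y)"
  by (intro bilinear_mapI linear_map_id vector_spaces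
      bilinear_map_left[OF mult_bilinear] bilinear_map_right[OF mult_bilinear]
      linear_map_comp[OF linear_iota] linear_letter_proj)

text \<open>Only the one-letter prefix survives the projection, so a nonempty word is its first
  letter times the rest; the empty word is covered by the counit term.\<close>

lemma first_letter_decomposition:
  "x = sT (counit sT \<iota> x) 1 + sweedler sT (deconc sT \<iota> x) (\<lambda>x y. \<iota> (letter_proj x) * y)"
proof (rule linear_map_eqI[where s = sT and f = "\<lambda>x. x"
    and g = "\<lambda>x. sT (counit sT \<iota> x) 1 + sweedler sT (deconc sT \<iota> x) (\<lambda>x y. \<iota> (letter_proj x) * y)"])
  show "Vector_Spaces.linear sT sT
    (\<lambda>x. sT (counit sT \<iota> x) 1 + sweedler sT (deconc sT \<iota> x) (\<lambda>x y. \<iota> (letter_proj x) * y))"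
    by (rule linear_map_add[OF linear_counit_one linear_sweedler_deconc[OF bilinear_letter_proj_mult
          linear_map_id]]) simp
  show "word \<iota> w = sT (counit sT \<iota> (word \<iota> w)) 1 +
      sweedler sT (deconc sT \<iota> (word \<iota> w)) (\<lambda>x y. \<iota> (letter_proj x) * y)" for w
    unfolding sweedler_deconc_word[OF bilinear_letter_proj_mult] letter_proj_word counit_word
      sum_splits_only_letter[of "\<lambda>a y. \<iota> a * word \<iota> y", unfolded zero mult_zero_left, OF refl]
    by (cases w) (simp_all add: word_simps)
qed (intro linear_rules)

lemma sweedler_counit_left_linear:
  assumes "Vector_Spaces.linear sT s f"
  shows "sweedler s (deconc sT \<iota> a) (\<lambda>x y. s (counit sT \<iota> x) (f y)) = f a"
proof -
  have "f a = f (sweedler sT (deconc sT \<iota> a) (\<lambda>x y. sT (counit sT \<iota> x) y))"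
    by (simp only: sweedler_counit_left)
  then show ?thesis
    using assms by (simp add: linear_map_image_sweedler[OF assms] Vector_Spaces.linear_iff)
qed

lemma sweedler_counit_right_linear:
  assumes "Vector_Spaces.linear sT s f"
  shows "sweedler s (deconc sT \<iota> a) (\<lambda>x y. s (counit sT \<iota> y) (f x)) = f a"
proof -
  have "f a = f (sweedler sT (deconc sT \<iota> a) (\<lambda>x y. sT (counit sT \<iota> y) x))"
    by (simp only: sweedler_counit_right)
  then show ?thesis
    using assms by (simp add: linear_map_image_sweedler[OF assms] Vector_Spaces.linear_iff)
qed

end

section \<open>Products in an arbitrary Com-PreLie bialgebra structure\<close>

locale tensor_com_prelie_bialgebra = tensor_algebra sV sT \<iota> +
    com_prelie_bialgebra sT "shuffle sT \<iota>" bul "deconc sT \<iota>"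
  for sV :: "'k::field \<Rightarrow> 'v::ab_group_add \<Rightarrow> 'v"
    and sT :: "'k \<Rightarrow> 't::ring_1 \<Rightarrow> 't"
    and \<iota> :: "'v \<Rightarrow> 't"
    and bul :: "'t \<Rightarrow> 't \<Rightarrow> 't"
begin

lemma sweedler_bul:
  assumes E: "bilinear_map sT sT s E"
  shows "sweedler s (deconc sT \<iota> (bul a b)) E =
    sweedler s (deconc sT \<iota> a) (\<lambda>x y. E x (bul y b)) +
    sweedler s (deconc sT \<iota> a) (\<lambda>x y. sweedler s (deconc sT \<iota> b) (\<lambda>z w. E (bul x z) (shuffle sT \<iota> y w)))"
proof -
  have s: "vector_space s" using E by (simp add: bilinear_map_def Vector_Spaces.linear_iff)
  then interpret S: vector_space s .
  show ?thesis
    using tens_eqD[OF coprod_bul[of a b] list_multilinear_of_bilinear[OF E] s]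
    by (simp add: tens_def lin_ext_sweedler_ten s
        Vector_Spaces.linear.axioms(3)[OF linear_lin_ext, THEN module_hom.add])
qed

lemmas bul_rules =
  bilinear_map_left[OF bul_bilinear] bilinear_map_right[OF bul_bilinear] linear_rules
  linear_map_comp[OF linear_counit] linear_map_comp[OF linear_letter_proj]
  linear_map_comp[OF linear_iota]
  bilinear_map_left[OF mult_bilinear] bilinear_map_right[OF mult_bilinear]

lemma counit_bul: "counit sT \<iota> (bul a b) = 0"
proof -
  let ?\<epsilon> = "counit sT \<iota>"
  have E: "bilinear_map sT sT (*) (\<lambda>x y. ?\<epsilon> x * ?\<epsilon> y)"
    by (intro bilinear_mapI linear_map_scale_const[of _ "(*)"] linear_map_scale_fun linear_counit vector_space_mult)
  \<comment> \<open>Multiplicativity of the counit splits off \<epsilon>(y), and the counit law then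
    collapses the sum over the cuts of \<open>b\<close>.\<close>
  have right: "sweedler (*) (deconc sT \<iota> b) (\<lambda>z w. ?\<epsilon> (bul x z) * (?\<epsilon> y * ?\<epsilon> w)) = ?\<epsilon> y * ?\<epsilon> (bul x b)"
    for x y
    using sweedler_counit_right_linear[of "(*)" "\<lambda>z. ?\<epsilon> y * ?\<epsilon> (bul x z)" b]
    by (simp add: linear_map_scale_const[of _ "(*)"] bul_rules mult_ac)
  have lin: "Vector_Spaces.linear sT (*) (\<lambda>x. ?\<epsilon> (bul x b))"
    by (intro bul_rules)
  have "?\<epsilon> (bul a b) = sweedler (*) (deconc sT \<iota> (bul a b)) (\<lambda>x y. ?\<epsilon> x * ?\<epsilon> y)"
    by (rule sweedler_counit_left_linear[OF linear_counit, symmetric])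
  also have "\<dots> = sweedler (*) (deconc sT \<iota> a) (\<lambda>x y. ?\<epsilon> x * ?\<epsilon> (bul y b)) +
      sweedler (*) (deconc sT \<iota> a) (\<lambda>x y. ?\<epsilon> y * ?\<epsilon> (bul x b))"
    by (simp only: sweedler_bul[OF E] counit_shuffle right)
  also have "\<dots> = ?\<epsilon> (bul a b) + ?\<epsilon> (bul a b)"
    by (simp only: sweedler_counit_left_linear[OF lin] sweedler_counit_right_linear[OF lin])
  finally show ?thesis by (simp only: add_cancel_right_right)
qed

text \<open>With this choice \<open>\<omega>_words\<close> and \<open>bullet\<close> refer to \<pi>
  composed with \<open>bul\<close>, so the earlier results apply to the candidate product.\<close>

sublocale tensor_algebra_bullet sV sT \<iota> "\<lambda>x y. letter_proj (bul x y)"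
  by unfold_locales (intro bul_rules)

lemma bul_word: "bul (word \<iota> u) (word \<iota> v) = sum_bullet \<omega>_words u v (word \<iota>)"
proof (induction u)
  \<comment> \<open>The recursion that determines \<open>bul\<close>: it has the shape of
    \<open>sum_bullet_simps\<close>, so the induction only has to compare the two.\<close>
  have bul_step: "bul (word \<iota> u) (word \<iota> v) =
    (case u of [] \<Rightarrow> 0 | a # u' \<Rightarrow> \<iota> a * bul (word \<iota> u') (word \<iota> v)) +
    sum_bullet_head \<omega>_words u v (word \<iota>)" for u
  proof -
    have inner: "\<iota> a * shuffle sT \<iota> (word \<iota> y) (word \<iota> z) = sum_shuffles y z (\<lambda>t. word \<iota> (a # t))"
      for a y z
      by (subst linear_shuffle_word[where s = sT and f = "\<lambda>t. \<iota> a * t"])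
        (intro bul_rules, simp add: word_simps)
    \<comment> \<open>The counit term of the first letter decomposition is zero by
      \<open>counit_bul\<close>.\<close>
    have "bul (word \<iota> u) (word \<iota> v) =
      sweedler sT (deconc sT \<iota> (bul (word \<iota> u) (word \<iota> v))) (\<lambda>x y. \<iota> (letter_proj x) * y)"
      by (subst first_letter_decomposition) (simp add: counit_bul)
    also have "\<dots> = sum_splits u (\<lambda>x y. \<iota> (only_letter x) * bul (word \<iota> y) (word \<iota> v)) +
      sum_splits u (\<lambda>x y. sum_splits v (\<lambda>z w.
        \<iota> (\<omega>_words x z) * shuffle sT \<iota> (word \<iota> y) (word \<iota> w)))"
      unfolding sweedler_bul[OF bilinear_letter_proj_mult]
      by ((subst sweedler_deconc_word, (intro bul_rules linear_letter_proj)[1])+) (simp only: letter_proj_word)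
    also have "sum_splits u (\<lambda>x y. \<iota> (only_letter x) * bul (word \<iota> y) (word \<iota> v)) =
      (case u of [] \<Rightarrow> 0 | a # u' \<Rightarrow> \<iota> a * bul (word \<iota> u') (word \<iota> v))"
      by (rule sum_splits_only_letter[of "\<lambda>a y. \<iota> a * bul (word \<iota> y) (word \<iota> v)"]) (simp add: zero)
    finally show ?thesis
      by (simp add: inner sum_bullet_head_def)
  qed
  {
    case Nil
    show ?case by (subst bul_step) (simp add: sum_bullet_simps)
  next
    case (Cons a u)
    have "\<iota> a * sum_bullet \<omega>_words u v (word \<iota>) = sum_bullet \<omega>_words u v (\<lambda>x. word \<iota> (a # x))"
      by (subst sum_bullet_additive[of "\<lambda>x. \<iota> a * x"]) (simp_all add: algebra_simps word_simps)
    then show ?case by (subst bul_step) (simp add: sum_bullet_simps Cons)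
  }
qed

lemma bul_eq_bullet: "bul = bullet sT \<iota> (\<lambda>x y. letter_proj (bul x y))"
  by (rule ext, rule ext, rule bilinear_map_eqI[where s = sT, OF bul_bilinear bullet_bilinear])
    (rule trans[OF bul_word bullet_word[symmetric]])

text \<open>The Leibniz rule is projected by \<open>letter_proj_shuffle\<close>; the two terms
  containing \<epsilon> of a product vanish by \<open>counit_bul\<close>.\<close>

lemma cond_A_letter_proj_bul: "cond_A sV sT \<iota> (\<lambda>x y. letter_proj (bul x y))"
  by (simp add: cond_A_def leibniz letter_proj_shuffle counit_bul linear_letter_proj
      linear_letter_proj[unfolded Vector_Spaces.linear_iff])

text \<open>Condition (B) is the image of the pre-Lie identity under \<pi>.\<close>

lemma cond_B_letter_proj_bul: "cond_B sT \<iota> (\<lambda>x y. letter_proj (bul x y))"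
proof -
  interpret P: Vector_Spaces.linear sT sV letter_proj by (rule linear_letter_proj)
  show ?thesis
    unfolding cond_B_def bul_eq_bullet[symmetric] by (simp only: P.diff[symmetric] prelie simp_thms)
qed

end

context tensor_algebra_bullet
begin

lemma letter_proj_bullet: "letter_proj (bullet sT \<iota> \<omega> x y) = \<omega> x y"
  by (rule bilinear_map_eqI[where s = sV and f = "\<lambda>x y. letter_proj (bullet sT \<iota> \<omega> x y)"
        and g = \<omega>], (intro bullet_rules linear_map_comp[OF linear_letter_proj])[1], rule \<omega>_bilinear)
    (simp add: linear_bullet_word[OF linear_letter_proj] letter_proj_word sum_bullet_only_letter)

end

section \<open>Homogeneity\<close>

context tensor_algebra
begin

lemma subspace_tpow: "vs2.subspace (tpow sT \<iota> p)"
  by (simp add: tpow_def)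

lemma word_in_tpow: "int (length w) = p \<Longrightarrow> word \<iota> w \<in> tpow sT \<iota> p"
  by (auto simp: tpow_def intro!: vs2.span_base)

lemma tpow_induct:
  assumes "x \<in> tpow sT \<iota> p" "vs2.subspace S" "\<And>w. int (length w) = p \<Longrightarrow> word \<iota> w \<in> S"
  shows "x \<in> S"
proof (cases "p < 0")
  case True
  then show ?thesis using assms(1,2) by (simp add: tpow_def vs2.subspace_0)
next
  case False
  then have "x \<in> vs2.span {word \<iota> w |w. int (length w) = p}"
    using assms(1) by (simp add: tpow_def)
  moreover have "vs2.span {word \<iota> w |w. int (length w) = p} \<subseteq> S"
    by (rule vs2.span_minimal[OF _ assms(2)]) (auto simp: assms(3))
  ultimately show ?thesis by auto
qed

lemma linear_tpow_in_subspace: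
  assumes "Vector_Spaces.linear sT s f" "module.subspace s S"
    and "x \<in> tpow sT \<iota> p" "\<And>w. int (length w) = p \<Longrightarrow> f (word \<iota> w) \<in> S"
  shows "f x \<in> S"
proof -
  interpret L: Vector_Spaces.linear sT s f by fact
  have "x \<in> f -` S"
    by (rule tpow_induct[OF assms(3) L.subspace_vimage[OF assms(2)]]) (simp add: assms(4))
  then show ?thesis by simp
qed

lemma letter_proj_tpow: "x \<in> tpow sT \<iota> p \<Longrightarrow> p \<noteq> 1 \<Longrightarrow> letter_proj x = 0"
  using linear_tpow_in_subspace[OF linear_letter_proj, of "{0}" x p]
  by (simp add: vs1.subspace_single_0 letter_proj_word only_letter_def)

end

context tensor_algebra_bullet
begin

text \<open>A term has the length of \<open>u\<close> and \<open>v\<close> together, less the pieces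
  consumed by \<omega>, plus one. This is the required degree exactly when the lengths of the
  consumed pieces and \<open>N\<close> add up to 1.\<close>

lemma bullet_word_in_tpow:
  assumes "\<And>x y. int (length x) + int (length y) + N \<noteq> 1 \<Longrightarrow> \<omega>_words x y = 0"
  shows "bullet sT \<iota> \<omega> (word \<iota> u) (word \<iota> v) \<in> tpow sT \<iota> (int (length u) + int (length v) + N)"
proof -
  let ?S = "tpow sT \<iota> (int (length u) + int (length v) + N)"
  have splits: "sum_splits w f \<in> ?S" if "\<And>x y. w = x @ y \<Longrightarrow> f x y \<in> ?S" for w :: "'v list" and f
    unfolding sum_splits_conv_sum by (rule vs2.subspace_sum[OF subspace_tpow]) (simp add: that)
  have list: "sum_list xs \<in> ?S" if "set xs \<subseteq> ?S" for xs
    using that by (induction xs) (simp_all add: vs2.subspace_0 vs2.subspace_add subspace_tpow)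
  have shuffles: "sum_shuffles x y f \<in> ?S"
    if "\<And>w. length w = length x + length y \<Longrightarrow> f w \<in> ?S" for x y :: "'v list" and f
    unfolding sum_shuffles_def by (rule list) (auto simp: that length_shuffle_list)
  show ?thesis
    unfolding bullet_word sum_bullet_def sum_bullet_head_def
  proof (intro splits shuffles)
    fix a b p q r s w :: "'v list"
    assume u: "u = a @ b" "b = p @ q" and v: "v = r @ s" and w: "length w = length q + length s"
    show "word \<iota> (a @ \<omega>_words p r # w) \<in> ?S"
    proof (cases "int (length p) + int (length r) + N = 1")
      case True
      then show ?thesis by (intro word_in_tpow) (simp add: u v w)
    next
      \<comment> \<open>The created letter is \<open>0\<close>, and a word containing the letter
        \<open>0\<close> vanishes by additivity.\<close>
      case False
      then show ?thesis
        using assms[of p r] letter_additive_0[OF letter_additive_word] subspace_tpow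
        by (simp add: vs2.subspace_0)
    qed
  qed
qed

lemma homogeneous_bullet_iff:
  "homogeneous sT \<iota> N (bullet sT \<iota> \<omega>) \<longleftrightarrow>
    (\<forall>k l :: nat. int k + int l + N \<noteq> 1 \<longrightarrow>
      (\<forall>x \<in> tpow sT \<iota> (int k). \<forall>y \<in> tpow sT \<iota> (int l). \<omega> x y = 0))" (is "_ \<longleftrightarrow> ?van")
proof
  assume "homogeneous sT \<iota> N (bullet sT \<iota> \<omega>)"
  \<comment> \<open>\<omega> is the letter projection of the product, and this projection kills
    every degree other than 1, negative ones included.\<close>
  then show ?van
    using letter_proj_tpow letter_proj_bullet unfolding homogeneous_def by metis
next
  assume van: ?van
  have word: "bullet sT \<iota> \<omega> (word \<iota> u) (word \<iota> v) \<in> tpow sT \<iota> (int (length u) + int (length v) + N)"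
    for u v
    by (rule bullet_word_in_tpow) (use van word_in_tpow in blast)
  show "homogeneous sT \<iota> N (bullet sT \<iota> \<omega>)"
    unfolding homogeneous_def
  proof (intro allI ballI)
    fix k l :: nat and x y
    assume x: "x \<in> tpow sT \<iota> (int k)" and y: "y \<in> tpow sT \<iota> (int l)"
    let ?S = "tpow sT \<iota> (int k + int l + N)"
    \<comment> \<open>The tensor powers are spanned by words, so the claim is extended linearly
      first in \<open>y\<close>, then in \<open>x\<close>.\<close>
    have "bullet sT \<iota> \<omega> (word \<iota> u) y \<in> ?S" if "length u = k" for u
      by (rule linear_tpow_in_subspace[where f = "\<lambda>y. bullet sT \<iota> \<omega> (word \<iota> u) y", OF _ subspace_tpow y])
        (intro bullet_rules, use word[of u] that in auto)
    then show "bullet sT \<iota> \<omega> x y \<in> ?S"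
      by (intro linear_tpow_in_subspace[where f = "\<lambda>x. bullet sT \<iota> \<omega> x y", OF _ subspace_tpow x])
        (intro bullet_rules, auto)
  qed
qed

end

theorem proposition2p3:
  fixes sV :: "'k::field_char_0 \<Rightarrow> 'v::ab_group_add \<Rightarrow> 'v"
    and sT :: "'k \<Rightarrow> 't::ring_1 \<Rightarrow> 't"
    and \<iota> :: "'v \<Rightarrow> 't"
  assumes "vector_space sV"
    and "tensor_algebra sV sT \<iota>"
  shows
    "(\<forall>\<omega>. bilinear_map sT sT sV \<omega> \<and> cond_A sV sT \<iota> \<omega> \<and> cond_B sT \<iota> \<omega> \<longrightarrow>
        com_prelie_bialgebra sT (shuffle sT \<iota>) (bullet sT \<iota> \<omega>) (deconc sT \<iota>)) \<and>
     (\<forall>bul. com_prelie_bialgebra sT (shuffle sT \<iota>) bul (deconc sT \<iota>) \<longrightarrow>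
        (\<exists>\<omega>. bilinear_map sT sT sV \<omega> \<and> cond_A sV sT \<iota> \<omega> \<and> cond_B sT \<iota> \<omega> \<and>
          bul = bullet sT \<iota> \<omega>)) \<and>
     (\<forall>\<omega>. bilinear_map sT sT sV \<omega> \<and> cond_A sV sT \<iota> \<omega> \<and> cond_B sT \<iota> \<omega> \<longrightarrow>
        (\<forall>N :: int. homogeneous sT \<iota> N (bullet sT \<iota> \<omega>) \<longleftrightarrow>
          (\<forall>k l :: nat. int k + int l + N \<noteq> 1 \<longrightarrow>
            (\<forall>x \<in> tpow sT \<iota> (int k). \<forall>y \<in> tpow sT \<iota> (int l). \<omega> x y = 0))))"
proof (intro conjI allI impI)
  fix \<omega>
  assume \<omega>: "bilinear_map sT sT sV \<omega> \<and> cond_A sV sT \<iota> \<omega> \<and> cond_B sT \<iota> \<omega>"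
  then interpret tensor_algebra_bullet sV sT \<iota> \<omega>
    by (intro tensor_algebra_bullet.intro tensor_algebra_bullet_axioms.intro assms) simp
  show "com_prelie_bialgebra sT (shuffle sT \<iota>) (bullet sT \<iota> \<omega>) (deconc sT \<iota>)"
    using \<omega> com_prelie_bialgebra_bullet by blast
  show "homogeneous sT \<iota> N (bullet sT \<iota> \<omega>) \<longleftrightarrow>
      (\<forall>k l :: nat. int k + int l + N \<noteq> 1 \<longrightarrow>
        (\<forall>x \<in> tpow sT \<iota> (int k). \<forall>y \<in> tpow sT \<iota> (int l). \<omega> x y = 0))" for N
    by (rule homogeneous_bullet_iff)
next
  fix bul
  assume "com_prelie_bialgebra sT (shuffle sT \<iota>) bul (deconc sT \<iota>)"
  then interpret tensor_com_prelie_bialgebra sV sT \<iota> bul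
    by (intro tensor_com_prelie_bialgebra.intro assms)
  show "\<exists>\<omega>. bilinear_map sT sT sV \<omega> \<and> cond_A sV sT \<iota> \<omega> \<and> cond_B sT \<iota> \<omega> \<and>
      bul = bullet sT \<iota> \<omega>"
    using \<omega>_bilinear cond_A_letter_proj_bul cond_B_letter_proj_bul bul_eq_bullet by blast
qed

end
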